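(* Let $\boldsymbol n=(n_1,n_2)\in\mathbb Z_{\ge0}^2$, $N=n_1+n_2$, and let $P_{\boldsymbol n}$ be a monic polynomial of degree $N$ satisfying $$\int_{\Delta_i}x^jP_{\boldsymbol n}(x)w_i(x)\,dx\begin{cases}=0,&j\le n_i-1,\\ \ne0,&j=n_i,\end{cases}\qquad i=1,2,$$ let $q_{\boldsymbol n,1},q_{\boldsymbol n,2}$ be the corresponding functions of the second kind, and let $R_{\boldsymbol n}=(A_1A_2v_1v_2)\,\mathfrak{Wrons}[P_{\boldsymbol n},q_{\boldsymbol n,1},q_{\boldsymbol n,2}]\not\equiv0$ (a polynomial). Define $$E_{\boldsymbol n}:=A_1^2A_2^2v_1v_2\det\begin{pmatrix}P_{\boldsymbol n}&q_{\boldsymbol n,1}&q_{\boldsymbol n,2}\\P_{\boldsymbol n}''&q_{\boldsymbol n,1}''&q_{\boldsymbol n,2}''\\P_{\boldsymbol n}'''&q_{\boldsymbol n,1}'''&q_{\boldsymbol n,2}'''\end{pmatrix},\qquad F_{\boldsymbol n}:=-A_1^2A_2^2v_1v_2\det\begin{pmatrix}P_{\boldsymbol n}'&q_{\boldsymbol n,1}'&q_{\boldsymbol n,2}'\\P_{\boldsymbol n}''&q_{\boldsymbol n,1}''&q_{\boldsymbol n,2}''\\P_{\boldsymbol n}'''&q_{\boldsymbol n,1}'''&q_{\boldsymbol n,2}'''\end{pmatrix}.$$ Then: a) $E_{\boldsymbol n}$ and $F_{\boldsymbol n}$ are polynomials, with $$\deg(E_{\boldsymbol n})\le\max\{\deg(A_1)+\sigma_2+\deg(R_{\boldsymbol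 n}),\ \deg(A_2)+\sigma_1+\deg(R_{\boldsymbol n}),\ \deg(B_1)+\deg(B_2)+\deg(R_{\boldsymbol n})\},$$ $$\deg(F_{\boldsymbol n})\le\sigma_1+\sigma_2+\deg(R_{\boldsymbol n})+1.$$ b) $P_{\boldsymbol n}$, $q_{\boldsymbol n,1}$ and $q_{\boldsymbol n,2}$ are solutions of the linear differential equation with polynomial coefficients $$A_1A_2R_{\boldsymbol n}\,y'''+\left[\left(A_1(2A_2'+B_2)+A_2(2A_1'+B_1)\right)R_{\boldsymbol n}-A_1A_2R_{\boldsymbol n}'\right]y''+E_{\boldsymbol n}\,y'+F_{\boldsymbol n}\,y=0.$$ c) In the particular case when $A_1=A_2=A$, $B_1=B_2=B$ (so that $w_1=w_2$ as analytic functions), $\sigma:=\max\{\deg(A)-2,\deg(B)-1\}=1$ and $n_1=n_2$, the differential equation in b) reduces to $$A^2y'''+2A(A'+B)y''+E_{\boldsymbol n}^*\,y'+F_{\boldsymbol n}^*\,y=0,$$ where $E_{\boldsymbol n}^*$ and $F_{\boldsymbol n}^*$ are polynomials of degree at most $4$ and $3$, respectively.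
   Context: Two semiclassical weights. For $i=1,2$: $A_i$ (monic) and $B_i$ are real polynomials; $\Delta_i\subset\mathbb R$ is a finite union of non-overlapping intervals joining real zeros of $A_i$ and possibly $\infty$ (with no zero of $A_i$ in the interior of these intervals); $w_i(z)=\exp\left(\int^z\frac{B_i(t)}{A_i(t)}dt\right)$ is a (multivalued) analytic function, and on each interval of $\Delta_i$ the weight, also denoted $w_i$, is positive and coincides up to a non-zero multiplicative constant with a boundary value $(w_i)_+$ of this function. Thus $w_i'/w_i=B_i/A_i$. Put $v_i=A_iw_i$. All moments are finite: $\int_{\Delta_i}|x|^m|w_i(x)|dx<+\infty$, $m=0,1,2,\dots$; as a consequence $z^mv_i(z)=0$ (in the limit sense) at the endpoints of every subinterval of $\Delta_i$. Put $\sigma_i=\max\{\deg(A_i)-2,\deg(B_i)-1\}$, assumed $\ge0$. When $A_1=A_2=A$ and $B_1=B_2=B$, the analytic functions $w_1,w_2$ are normalized so that $w_1=w_2=\exp\left(\int^zB/A\right)$ for every selection of the branch. Functions of the second kind: $q_{\boldsymbol n,i}(z)=\frac1{w_i(z)}\int_{\Delta_i}\frac{P_{\boldsymbol n}(t)w_i(t)}{t-z}dt$ (possibly multivalued; differential equations for them are understood locally, for any branch, away from $\Delta_i$ and the zeros of $A_i$). $\mathfrak{Wrons}[f_1,\dots,f_k]=\det\left(f_j^{(i-1)}\right)_{i,j=1}^k$ is the Wronskian determinant. Standing assumption: $\mathfrak{Wrons}[P_{\boldsymbol n},q_{\boldsymbol n,1},q_{\boldsymbol n,2}]\not\equiv0$.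 *)

theory Defs
  imports "HOL-Complex_Analysis.Complex_Analysis"
begin

abbreviation cpoly :: "real poly \<Rightarrow> complex poly" where
  "cpoly p \<equiv> map_poly complex_of_real p"

text \<open>
  A single-valued branch, on a domain \<open>D\<close>, of the multivalued function
  \<open>w(z) = exp (\<integral>\<^sup>z B/A)\<close>; the lower limit of integration, hence a non-zero constant factor,
  is left free.
\<close>
definition is_branch ::
    "real poly \<Rightarrow> real poly \<Rightarrow> complex set \<Rightarrow> (complex \<Rightarrow> complex) \<Rightarrow> bool" where
  "is_branch A B D w \<longleftrightarrow>
     open D \<and> connected D \<and> (\<forall>z\<in>D. poly (cpoly A) z \<noteq> 0) \<and>
     (\<exists>\<Phi>. \<forall>z\<in>D. (\<Phi> has_field_derivative poly (cpoly B) z / poly (cpoly A) z) (at z) \<and>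
               w z = exp (\<Phi> z))"

text \<open>
  A finite union of intervals is given by the finite set \<open>J\<close> of its pairs of end points in
  the extended reals.
\<close>
definition support_intervals :: "real poly \<Rightarrow> (ereal \<times> ereal) set \<Rightarrow> bool" where
  "support_intervals A J \<longleftrightarrow>
     finite J \<and>
     (\<forall>(a, b)\<in>J. a < b \<and>
        (a = -\<infinity> \<or> (\<exists>x. a = ereal x \<and> poly A x = 0)) \<and>
        (b = \<infinity> \<or> (\<exists>x. b = ereal x \<and> poly A x = 0)) \<and>
        (\<forall>x\<in>einterval a b. poly A x \<noteq> 0)) \<and>
     (\<forall>(a, b)\<in>J. \<forall>(c, d)\<in>J. (a, b) \<noteq> (c, d) \<longrightarrow> einterval a b \<inter> einterval c d = {})"

definition Delta :: "(ereal \<times> ereal) set \<Rightarrow> real set" where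
  "Delta J = (\<Union>(a, b)\<in>J. {x. a \<le> ereal x \<and> ereal x \<le> b})"

text \<open>
  On the interval \<open>I\<close>, \<open>\<rho>\<close> is a non-zero multiple of the boundary value from the upper half
  plane of a branch of \<open>w\<close>.  As \<open>A\<close> may have non-real zeros, the branch is only asked to live on
  a connected one-sided neighbourhood of \<open>I\<close>.
\<close>
definition boundary_value_on ::
    "real poly \<Rightarrow> real poly \<Rightarrow> real set \<Rightarrow> (real \<Rightarrow> real) \<Rightarrow> bool" where
  "boundary_value_on A B I \<rho> \<longleftrightarrow>
     (\<exists>U w c. is_branch A B U w \<and> U \<subseteq> {z. Im z > 0} \<and> c \<noteq> 0 \<and>
        (\<forall>x\<in>I. (\<exists>e>0. ball (of_real x) e \<inter> {z. Im z > 0} \<subseteq> U) \<and>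
               (w \<longlongrightarrow> c * of_real (\<rho> x)) (at (of_real x) within {z. Im z > 0})))"

definition semiclassical_weight ::
    "real poly \<Rightarrow> real poly \<Rightarrow> (ereal \<times> ereal) set \<Rightarrow> (real \<Rightarrow> real) \<Rightarrow> bool" where
  "semiclassical_weight A B J \<rho> \<longleftrightarrow>
     lead_coeff A = 1 \<and> support_intervals A J \<and>
     (\<forall>(a, b)\<in>J. (\<forall>x\<in>einterval a b. \<rho> x > 0) \<and> boundary_value_on A B (einterval a b) \<rho>) \<and>
     (\<forall>m. set_integrable lborel (Delta J) (\<lambda>x. \<bar>x\<bar> ^ m * \<bar>\<rho> x\<bar>))"

text \<open>Integer-valued, so that the subtractions are not truncated.\<close>
definition weight_class :: "real poly \<Rightarrow> real poly \<Rightarrow> int" where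
  "weight_class A B = max (int (degree A) - 2) (int (degree B) - 1)"

definition weighted_moment ::
    "(ereal \<times> ereal) set \<Rightarrow> (real \<Rightarrow> real) \<Rightarrow> complex poly \<Rightarrow> nat \<Rightarrow> complex" where
  "weighted_moment J \<rho> P j =
     (LINT x:Delta J|lborel. of_real x ^ j * poly P (of_real x) * of_real (\<rho> x))"

text \<open>
  The function of the second kind belonging to the branch \<open>w\<close>; under the integral sign stands
  the positive weight \<open>\<rho>\<close>.
\<close>
definition second_kind ::
    "(ereal \<times> ereal) set \<Rightarrow> (real \<Rightarrow> real) \<Rightarrow> complex poly \<Rightarrow> (complex \<Rightarrow> complex) \<Rightarrow>
     complex \<Rightarrow> complex" where
  "second_kind J \<rho> P w z =
     1 / w z * (LINT t:Delta J|lborel. poly P (of_real t) * of_real (\<rho> t) / (of_real t - z))"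

definition branch_off_support ::
    "real poly \<Rightarrow> real poly \<Rightarrow> (ereal \<times> ereal) set \<Rightarrow> complex set \<Rightarrow> (complex \<Rightarrow> complex) \<Rightarrow> bool"
  where
  "branch_off_support A B J D w \<longleftrightarrow> is_branch A B D w \<and> D \<inter> of_real ` Delta J = {}"

text \<open>The determinant whose rows are the derivatives of orders \<open>i\<close>, \<open>j\<close>, \<open>k\<close>.\<close>
definition deriv_det ::
    "nat \<Rightarrow> nat \<Rightarrow> nat \<Rightarrow> (complex \<Rightarrow> complex) \<Rightarrow> (complex \<Rightarrow> complex) \<Rightarrow> (complex \<Rightarrow> complex) \<Rightarrow>
     complex \<Rightarrow> complex" where
  "deriv_det i j k f g h z =
     det (vector [vector [(deriv ^^ i) f z, (deriv ^^ i) g z, (deriv ^^ i) h z],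
                  vector [(deriv ^^ j) f z, (deriv ^^ j) g z, (deriv ^^ j) h z],
                  vector [(deriv ^^ k) f z, (deriv ^^ k) g z, (deriv ^^ k) h z]] :: complex^3^3)"

abbreviation Wrons ::
    "(complex \<Rightarrow> complex) \<Rightarrow> (complex \<Rightarrow> complex) \<Rightarrow> (complex \<Rightarrow> complex) \<Rightarrow> complex \<Rightarrow> complex" where
  "Wrons f g h \<equiv> deriv_det 0 1 2 f g h"

definition solves_ode3 ::
    "complex poly \<Rightarrow> complex poly \<Rightarrow> complex poly \<Rightarrow> complex poly \<Rightarrow> complex set \<Rightarrow>
     (complex \<Rightarrow> complex) \<Rightarrow> bool" where
  "solves_ode3 c3 c2 c1 c0 D y \<longleftrightarrow>
     y holomorphic_on D \<and>
     (\<forall>z\<in>D. poly c3 z * (deriv ^^ 3) y z + poly c2 z * (deriv ^^ 2) y z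
            + poly c1 z * deriv y z + poly c0 z * y z = 0)"

end

theory Submission
  imports Defs
begin

text \<open>
  Three ideas carry the theorem. The first is that every function in it has a purely algebraic description. For
  a semiclassical weight the Stieltjes transform \<open>\<Psi>(z) = \<integral> w(t)/(t - z) dt\<close> solves a
  first-order equation \<open>A \<Psi>' = B \<Psi> + C\<close> with a polynomial \<open>C\<close>
  (\<open>stieltjes_ode\<close>). This is the Pearson equation \<open>(A w)' = (A' + B) w\<close> integrated
  against \<open>1/(t - z)\<close>; the boundary terms vanish because \<open>A w\<close> takes arbitrarily small
  values close to each end point, otherwise some moment would be infinite (\<open>small_near_left_end\<close>).
  Division with remainder gives \<open>\<integral> P(t) w(t)/(t - z) dt = P \<Psi> + T\<close> with a polynomial
  \<open>T\<close>. Hence \<open>q = P u + T/w\<close> with \<open>u = \<Psi>/w\<close> and \<open>u' = C/(A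
  w)\<close>, and by induction \<open>q^(k) = P^(k) u + S_k/(A^k w)\<close> with polynomials \<open>S_k\<close>
  (\<open>second_kind_derivatives\<close>). In a determinant with the columns \<open>P\<close>,
  \<open>q1\<close>, \<open>q2\<close> the multiples \<open>P^(k) u\<close> of the first column drop out, and
  what remains are determinants of polynomials. So \<open>R\<close>, \<open>E\<close> and \<open>F\<close> are
  polynomials and do not depend on the branches. The differential equation is the expansion of a determinant
  with a repeated column, together with Wronski's identity for the derivative of \<open>R\<close>, which
  computes the coefficient of \<open>y''\<close>.

  The second idea gives the degrees. Eliminating \<open>F\<close> between the equations of \<open>P\<close> and
  \<open>q1\<close> expresses \<open>E\<close> through \<open>P\<close> and the polynomial \<open>G = A1 w1 (P
  q1' - P' q1)\<close>, which is non-zero because \<open>R\<close> is (\<open>E_factorisation\<close>). The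
  bound for \<open>E\<close> is read off from this formula, the one for \<open>F\<close> from the equation of
  \<open>P\<close>.

  The third concerns two weights with the same \<open>A\<close> and \<open>B\<close>. Row operations show that
  \<open>A\<^sup>2\<close> divides \<open>R\<close>, \<open>E\<close> and \<open>F\<close>. The quotient
  \<open>R/A\<^sup>2\<close> is a determinant in \<open>P w\<close> and the two Cauchy transforms, of which a
  linear combination decays one order faster than the orthogonality alone gives. For \<open>\<sigma> = 1\<close>
  and \<open>n1 = n2\<close> this makes \<open>R/A\<^sup>2\<close> bounded on the imaginary axis, hence constant
  (\<open>equal_weight_core_constant\<close>), so \<open>R\<close> is a constant multiple of
  \<open>A\<^sup>2\<close> and the whole equation can be divided by \<open>R\<close>.
\<close>

section \<open>Determinants of rows of derivatives\<close>

definition row_det ::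
    "(nat \<Rightarrow> 'a::comm_ring_1) \<Rightarrow> (nat \<Rightarrow> 'a) \<Rightarrow> (nat \<Rightarrow> 'a) \<Rightarrow> nat \<Rightarrow> nat \<Rightarrow> nat \<Rightarrow> 'a" where
  "row_det a b c i j k =
     a i * (b j * c k - b k * c j) - a j * (b i * c k - b k * c i) + a k * (b i * c j - b j * c i)"

lemma deriv_det_eq_row_det:
  "deriv_det i j k f g h z =
     row_det (\<lambda>n. (deriv ^^ n) f z) (\<lambda>n. (deriv ^^ n) g z) (\<lambda>n. (deriv ^^ n) h z) i j k"
  by (simp add: deriv_det_def row_det_def det_3 vector_3 algebra_simps)

text \<open>
  This removes the transcendental part of both functions of the second kind: their derivatives
  are those of \<open>P\<close>, times a common factor, plus rational multiples of \<open>1/w\<close>.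
\<close>

lemma row_det_column_operation:
  "row_det a (\<lambda>n. a n * u + b n) (\<lambda>n. a n * v + c n) i j k = row_det a b c i j k"
  by (simp add: row_det_def algebra_simps)

text \<open>
  Laplace expansion of a \<open>4 \<times> 4\<close> determinant whose last column \<open>y\<close> repeats one of the others.
\<close>

lemma row_det_cramer:
  assumes "y = a \<or> y = b \<or> y = c"
  shows "row_det a b c 0 1 2 * y 3 - row_det a b c 0 1 3 * y 2 + row_det a b c 0 2 3 * y 1
           - row_det a b c 1 2 3 * y 0 = 0"
  using assms by (elim disjE) (simp_all add: row_det_def algebra_simps)

section \<open>Numerators of the derivatives of a function of the second kind\<close>

text \<open>
  The polynomials \<open>S_k\<close> with \<open>q^(k) = P^(k) u + S_k/(A^k w)\<close>, where \<open>q = P u + T/w\<close>,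
  \<open>w' = (B/A) w\<close> and \<open>u' = C/(A w)\<close>. The recursion comes from differentiating this formula.
\<close>

primrec second_kind_numerator ::
    "'a::idom poly \<Rightarrow> 'a poly \<Rightarrow> 'a poly \<Rightarrow> 'a poly \<Rightarrow> 'a poly \<Rightarrow> nat \<Rightarrow> 'a poly" where
  "second_kind_numerator A B C P T 0 = T"
| "second_kind_numerator A B C P T (Suc k) =
     A ^ k * (pderiv ^^ k) P * C + A * pderiv (second_kind_numerator A B C P T k)
       - (of_nat k * pderiv A + B) * second_kind_numerator A B C P T k"

text \<open>
  The common denominator \<open>A^m w\<close> in place of \<open>A^k w\<close>, so that all entries of a column are
  polynomials; it is used for \<open>k \<le> m\<close>.
\<close>

definition scaled_numerator ::
    "'a::idom poly \<Rightarrow> 'a poly \<Rightarrow> 'a poly \<Rightarrow> 'a poly \<Rightarrow> 'a poly \<Rightarrow> nat \<Rightarrow> nat \<Rightarrow> 'a poly" where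
  "scaled_numerator A B C P T m k = A ^ (m - k) * second_kind_numerator A B C P T k"

lemma scaled_numerator_Suc:
  assumes "k \<le> m"
  shows "scaled_numerator A B C P T (Suc m) k = A * scaled_numerator A B C P T m k"
  using assms by (simp add: scaled_numerator_def Suc_diff_le)

lemma pderiv_power_mult: "A * pderiv (A ^ n) = of_nat n * pderiv A * A ^ n"
  for A :: "'a::idom poly"
  by (cases n) (simp_all add: pderiv_power of_nat_poly mult_ac del: of_nat_Suc power_Suc, simp add: mult_ac)

text \<open>
  Up to a multiple of the column of \<open>P\<close> and of the column itself, differentiation shifts a column
  by one row, as it does for a column of successive derivatives. The multiple of the column itself is
  the logarithmic derivative of the scaling factor \<open>A^m w\<close>.
\<close>

lemma scaled_numerator_pderiv:
  assumes "k \<le> m"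
  shows "A * pderiv (scaled_numerator A B C P T m k) =
     (of_nat m * pderiv A + B) * scaled_numerator A B C P T m k
     + scaled_numerator A B C P T (Suc m) (Suc k) - A ^ m * C * (pderiv ^^ k) P"
proof -
  let ?S = "second_kind_numerator A B C P T k" and ?X = "A ^ (m - k)"
  have m: "of_nat m = (of_nat (m - k) + of_nat k :: 'a poly)" "A ^ m = ?X * A ^ k"
    using assms by (simp_all flip: of_nat_add power_add)
  have "A * pderiv (?X * ?S) = of_nat (m - k) * pderiv A * ?X * ?S + ?X * (A * pderiv ?S)"
    unfolding pderiv_mult pderiv_power_mult[symmetric] by (simp add: algebra_simps)
  then show ?thesis
    by (simp add: scaled_numerator_def m algebra_simps)
qed

section \<open>Degree bounds for possibly vanishing polynomials\<close>

text \<open>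
  The bound is an integer and the zero polynomial satisfies every bound. This lets differentiation
  lower the bound by one without exception, also for constants.
\<close>

definition degree_le :: "'a::zero poly \<Rightarrow> int \<Rightarrow> bool" where
  "degree_le p d \<longleftrightarrow> p = 0 \<or> int (degree p) \<le> d"

lemma degree_le_degree: "degree_le p (int (degree p))"
  by (simp add: degree_le_def)

lemma degree_le_mono: "degree_le p d \<Longrightarrow> d \<le> d' \<Longrightarrow> degree_le p d'"
  by (auto simp: degree_le_def)

lemma degree_le_minus: "degree_le p d \<Longrightarrow> degree_le (- p) d"
  by (auto simp: degree_le_def)

lemma degree_le_add: "degree_le p d \<Longrightarrow> degree_le q d \<Longrightarrow> degree_le (p + q) d"
  using degree_add_le_max[of p q] by (auto simp: degree_le_def)

lemma degree_le_diff: "degree_le p d \<Longrightarrow> degree_le q d \<Longrightarrow> degree_le (p - q) d"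
  for p q :: "'a::ab_group_add poly"
  using degree_le_add[of p d "- q"] degree_le_minus[of q d] by simp

lemma degree_le_mult:
  "degree_le p d \<Longrightarrow> degree_le q e \<Longrightarrow> degree_le (p * q) (d + e)"
  using degree_mult_le[of p q] by (auto simp: degree_le_def)

lemma degree_le_cancel:
  "degree_le (p * q) (d + int (degree q)) \<Longrightarrow> q \<noteq> 0 \<Longrightarrow> degree_le p d"
  for p q :: "'a::idom poly"
  by (cases "p = 0") (auto simp: degree_le_def degree_mult_eq)

lemma degree_le_pderiv:
  "degree_le p d \<Longrightarrow> degree_le (pderiv p) (d - 1)" for p :: "'a::{idom,ring_char_0} poly"
  by (cases "degree p = 0") (auto simp: degree_le_def degree_pderiv pderiv_eq_0_iff)

section \<open>The coefficients of the differential equation\<close>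

text \<open>
  The locale has no assumptions: the differential equation and the degree bounds are identities of
  polynomials in \<open>P\<close> and in the data \<open>A, B, C, T\<close> of the two functions of the second kind.
\<close>

locale ode_polynomials =
  fixes A1 B1 C1 T1 A2 B2 C2 T2 P :: "'a::{idom,ring_char_0} poly"
begin

text \<open>
  This is \<open>A1^m w1 A2^m w2\<close> times the determinant of the derivatives of orders \<open>i, j, k\<close> of \<open>P\<close>, \<open>q1\<close>
  and \<open>q2\<close>. Derivatives of order three need \<open>m = 3\<close>, the Wronskian only \<open>m = 2\<close>.
\<close>

definition D :: "nat \<Rightarrow> nat \<Rightarrow> nat \<Rightarrow> nat \<Rightarrow> 'a poly" where
  "D m = row_det (\<lambda>k. (pderiv ^^ k) P)
           (scaled_numerator A1 B1 C1 P T1 m) (scaled_numerator A2 B2 C2 P T2 m)"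

definition R :: "'a poly" where "R = D 2 0 1 2"
definition E :: "'a poly" where "E = D 3 0 2 3"
definition F :: "'a poly" where "F = - D 3 1 2 3"
definition c3 :: "'a poly" where "c3 = A1 * A2 * R"
definition c2 :: "'a poly" where
  "c2 = (A1 * (2 * pderiv A2 + B2) + A2 * (2 * pderiv A1 + B1)) * R - A1 * A2 * pderiv R"

lemma c3_eq: "c3 = D 3 0 1 2"
  using scaled_numerator_Suc[of _ 2 A1 B1 C1 P T1] scaled_numerator_Suc[of _ 2 A2 B2 C2 P T2]
  by (simp add: c3_def R_def D_def row_det_def numeral_3_eq_3 algebra_simps)

text \<open>
  The derivative of the Wronskian of three functions is the determinant of their derivatives of orders
  0, 1 and 3. The terms with \<open>A'\<close> and \<open>B\<close> in \<open>c2\<close> come from differentiating the scaling factor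
  \<open>A1\<^sup>2 w1 A2\<^sup>2 w2\<close> of \<open>R\<close>.
\<close>

lemma c2_eq: "c2 = - D 3 0 1 3"
proof -
  define a where "a k = (pderiv ^^ k) P" for k
  define b where "b = scaled_numerator A1 B1 C1 P T1 2"
  define c where "c = scaled_numerator A2 B2 C2 P T2 2"
  define x where "x = scaled_numerator A1 B1 C1 P T1 3"
  define y where "y = scaled_numerator A2 B2 C2 P T2 3"
  have da: "pderiv (a k) = a (Suc k)" for k by (simp add: a_def)
  have db: "A1 * pderiv (b k) = (2 * pderiv A1 + B1) * b k + x (Suc k) - A1\<^sup>2 * C1 * a k" if "k \<le> 2" for k
    using scaled_numerator_pderiv[OF that, of A1 B1 C1 P T1]
    by (simp add: b_def x_def a_def numeral_3_eq_3 numeral_2_eq_2)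
  have dc: "A2 * pderiv (c k) = (2 * pderiv A2 + B2) * c k + y (Suc k) - A2\<^sup>2 * C2 * a k" if "k \<le> 2" for k
    using scaled_numerator_pderiv[OF that, of A2 B2 C2 P T2]
    by (simp add: c_def y_def a_def numeral_3_eq_3 numeral_2_eq_2)
  have xb: "x k = A1 * b k" if "k \<le> 2" for k
    using scaled_numerator_Suc[OF that, of A1 B1 C1 P T1] by (simp add: x_def b_def numeral_3_eq_3)
  have yc: "y k = A2 * c k" if "k \<le> 2" for k
    using scaled_numerator_Suc[OF that, of A2 B2 C2 P T2] by (simp add: y_def c_def numeral_3_eq_3)
  have "A1 * A2 * pderiv (row_det a b c 0 1 2) =
      A1 * A2 * row_det (\<lambda>k. pderiv (a k)) b c 0 1 2
      + A2 * row_det a (\<lambda>k. A1 * pderiv (b k)) c 0 1 2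
      + A1 * row_det a b (\<lambda>k. A2 * pderiv (c k)) 0 1 2"
    by (simp add: row_det_def pderiv_add pderiv_diff pderiv_mult algebra_simps)
  also have "row_det a (\<lambda>k. A1 * pderiv (b k)) c 0 1 2 =
      (2 * pderiv A1 + B1) * row_det a b c 0 1 2 + row_det a (\<lambda>k. x (Suc k)) c 0 1 2"
    by (simp add: row_det_def db algebra_simps)
  also have "row_det a b (\<lambda>k. A2 * pderiv (c k)) 0 1 2 =
      (2 * pderiv A2 + B2) * row_det a b c 0 1 2 + row_det a b (\<lambda>k. y (Suc k)) 0 1 2"
    by (simp add: row_det_def dc algebra_simps)
  finally have R': "A1 * A2 * pderiv R = (A1 * (2 * pderiv A2 + B2) + A2 * (2 * pderiv A1 + B1)) * R
      + (A1 * A2 * row_det (\<lambda>k. pderiv (a k)) b c 0 1 2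
      + A2 * row_det a (\<lambda>k. x (Suc k)) c 0 1 2 + A1 * row_det a b (\<lambda>k. y (Suc k)) 0 1 2)"
    unfolding R_def D_def a_def[symmetric] b_def[symmetric] c_def[symmetric]
    by (simp add: algebra_simps)
  have "A1 * A2 * row_det (\<lambda>k. pderiv (a k)) b c 0 1 2
      + A2 * row_det a (\<lambda>k. x (Suc k)) c 0 1 2 + A1 * row_det a b (\<lambda>k. y (Suc k)) 0 1 2
      = row_det a x y 0 1 3"
    by (simp add: row_det_def da xb yc eval_nat_numeral algebra_simps)
  moreover have "row_det a x y 0 1 3 = D 3 0 1 3"
    by (simp add: D_def a_def[abs_def] x_def y_def)
  ultimately show ?thesis
    unfolding c2_def R' by simp
qed

lemma ode_columns:
  assumes "y = (\<lambda>k. (pderiv ^^ k) P) \<or> y = scaled_numerator A1 B1 C1 P T1 3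
             \<or> y = scaled_numerator A2 B2 C2 P T2 3"
  shows "c3 * y 3 + c2 * y 2 + E * y 1 + F * y 0 = 0"
  using row_det_cramer[OF assms] unfolding c3_eq c2_eq E_def F_def D_def by simp

lemma ode_P: "c3 * (pderiv ^^ 3) P + c2 * (pderiv ^^ 2) P + E * pderiv P + F * P = 0"
  using ode_columns[of "\<lambda>k. (pderiv ^^ k) P"] by simp

section \<open>The degrees of the lower coefficients\<close>

text \<open>
  The identity \<open>(P q1' - P' q1)' = P q1'' - P'' q1\<close> with the denominators cleared: here
  \<open>G = A1 w1 (P q1' - P' q1)\<close>.
\<close>

lemma first_wronskian_derivative:
  fixes G
  defines "S \<equiv> second_kind_numerator A1 B1 C1 P T1"
  assumes G: "G = P * S 1 - pderiv P * A1 * T1"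
  shows "A1 * pderiv G - (pderiv A1 + B1) * G = P * S 2 - pderiv (pderiv P) * A1^2 * T1"
proof -
  have "A1 * pderiv (S 1) = S 2 + (pderiv A1 + B1) * S 1 - A1 * pderiv P * C1"
     "A1 * pderiv T1 = S 1 - P * C1 + B1 * T1"
    by (simp_all add: S_def numeral_2_eq_2 algebra_simps)
  note * = this
  have "A1 * pderiv G = A1 * pderiv P * S 1 + P * (A1 * pderiv (S 1))
     - A1 * pderiv (pderiv P) * A1 * T1 - pderiv P * pderiv A1 * A1 * T1 - pderiv P * A1 * (A1 * pderiv T1)"
    by (simp add: G pderiv_mult pderiv_diff algebra_simps)
  then show ?thesis unfolding * by (simp add: G algebra_simps power2_eq_square)
qed

text \<open>
  With \<open>W = P q1' - P' q1\<close>, eliminating \<open>F\<close> from the equations of \<open>P\<close> and \<open>q1\<close> gives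
  \<open>E W P = - (c3 (P W'' - P' W' + P'' W) + c2 P W')\<close>. After the denominators of \<open>W = G/(A1 w1)\<close> are
  cleared, the terms in \<open>W''\<close> and \<open>W'\<close> that would grow too fast cancel against the summand
  \<open>A2 (2 A1' + B1) R\<close> of \<open>c2\<close>, and a factor \<open>A1\<^sup>2\<close> splits off. Without this cancellation the formula would
  give a weaker degree bound.
\<close>

lemma E_factorisation:
  fixes G G1
  assumes A1: "A1 \<noteq> 0"
  assumes G: "G = P * second_kind_numerator A1 B1 C1 P T1 1 - pderiv P * A1 * T1"
    and G1: "G1 = A1 * pderiv G - (pderiv A1 + B1) * G"
  shows "E * G * P = - (P * (A2 * R * pderiv G1 + (2 * pderiv A2 + B2) * R * G1 - A2 * pderiv R * G1)
            + A2 * R * (A1 * pderiv (pderiv P) * G - pderiv P * G1))"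
proof -
  define S where "S = second_kind_numerator A1 B1 C1 P T1"
  define p where "p k = (pderiv ^^ k) P" for k
  have p0: "P = p 0" "pderiv P = p 1" "pderiv (pderiv P) = p 2" and dp0: "pderiv (p 0) = p (Suc 0)" and dp2: "pderiv (p 2) = p 3"
    by (simp_all add: p_def eval_nat_numeral)
  have G': "G = p 0 * S 1 - p 1 * A1 * T1" using G unfolding p0[symmetric] S_def .
  have G1': "G1 = p 0 * S 2 - p 2 * A1^2 * T1"
    using first_wronskian_derivative[OF G] unfolding G1 p0[symmetric] S_def .
  have "A1 * pderiv (S 2) = S 3 + (2 * pderiv A1 + B1) * S 2 - A1^2 * p 2 * C1"
     "A1 * pderiv T1 = S 1 - p 0 * C1 + B1 * T1"
    using second_kind_numerator.simps(2)[of A1 B1 C1 P T1 2]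
    by (simp_all add: S_def p_def algebra_simps del: funpow.simps)
  note S2' = this
  have "A1 * pderiv G1 = A1 * p 1 * S 2 + p 0 * (A1 * pderiv (S 2))
     - A1 * p 3 * A1^2 * T1 - 2 * p 2 * pderiv A1 * A1^2 * T1 - p 2 * A1^2 * (A1 * pderiv T1)"
    by (simp add: G1' pderiv_mult pderiv_diff dp0 dp2 power2_eq_square algebra_simps)
  then have G2: "A1 * pderiv G1 = p 0 * S 3 - p 3 * A1^3 * T1 + A1 * (p 1 * S 2 - p 2 * A1 * S 1)
       + (2 * pderiv A1 + B1) * G1"
    unfolding S2' by (simp add: G1' algebra_simps power2_eq_square power3_eq_cube)
  have e1: "c3 * p 3 + c2 * p 2 + E * p 1 + F * p 0 = 0"
    using ode_columns[of p] by (simp add: p_def[abs_def])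
  have e2: "c3 * S 3 + A1 * c2 * S 2 + A1^2 * E * S 1 + A1^3 * F * T1 = 0"
    using ode_columns[of "scaled_numerator A1 B1 C1 P T1 3"]
    by (simp add: scaled_numerator_def S_def eval_nat_numeral algebra_simps)
  have elim: "c3 * (p 0 * S 3 - p 3 * A1^3 * T1) + A1 * c2 * G1 + A1^2 * E * G = 0"
  proof -
    have "c3 * (p 0 * S 3 - p 3 * A1^3 * T1) + A1 * c2 * G1 + A1^2 * E * G =
       p 0 * (c3 * S 3 + A1 * c2 * S 2 + A1^2 * E * S 1 + A1^3 * F * T1)
       - A1^3 * T1 * (c3 * p 3 + c2 * p 2 + E * p 1 + F * p 0)"
      unfolding G1' G' by (simp add: algebra_simps power2_eq_square power3_eq_cube)
    then show ?thesis unfolding e1 e2 by simp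
  qed
  \<comment> \<open>The minor \<open>P' q1'' - P'' q1'\<close>, left over in the derivative of \<open>G1\<close>, becomes a combination of
    \<open>G\<close> and \<open>G1\<close> after multiplication by \<open>P\<close>.\<close>
  have mid: "p 0 * (p 1 * S 2 - p 2 * A1 * S 1) = p 1 * G1 - p 2 * A1 * G"
    unfolding G1' G' by (simp add: algebra_simps power2_eq_square)
  have "A1^2 * (E * G * p 0) = - p 0 * (c3 * (p 0 * S 3 - p 3 * A1^3 * T1) + A1 * c2 * G1)"
    using elim by algebra
  also have "p 0 * S 3 - p 3 * A1^3 * T1 = A1 * pderiv G1 - (2 * pderiv A1 + B1) * G1
      - A1 * (p 1 * S 2 - p 2 * A1 * S 1)"
    using G2 by (simp add: algebra_simps)
  also have "- p 0 * (c3 * (A1 * pderiv G1 - (2 * pderiv A1 + B1) * G1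
        - A1 * (p 1 * S 2 - p 2 * A1 * S 1)) + A1 * c2 * G1)
     = - p 0 * (c3 * (A1 * pderiv G1 - (2 * pderiv A1 + B1) * G1) + A1 * c2 * G1)
        + c3 * A1 * (p 1 * G1 - p 2 * A1 * G)"
    unfolding mid[symmetric] by (simp add: algebra_simps)
  also have "\<dots> = A1^2 * (- (p 0 * (A2 * R * pderiv G1 + (2 * pderiv A2 + B2) * R * G1 - A2 * pderiv R * G1)
            + A2 * R * (A1 * p 2 * G - p 1 * G1)))"
    unfolding c3_def c2_def by (simp add: algebra_simps power2_eq_square)
  finally show ?thesis using A1 unfolding p0[symmetric] by simp
qed

text \<open>
  If \<open>P q1' - P' q1\<close> vanishes then so does \<open>P q1'' - P'' q1\<close>; the columns of \<open>P\<close> and \<open>q1\<close> are then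
  proportional and the Wronskian \<open>R\<close> of all three functions is zero.
\<close>

lemma first_wronskian_nonzero:
  assumes "A1 \<noteq> 0" "P \<noteq> 0" "R \<noteq> 0"
  shows "P * second_kind_numerator A1 B1 C1 P T1 1 - pderiv P * A1 * T1 \<noteq> 0"
proof
  define S where "S = second_kind_numerator A1 B1 C1 P T1"
  assume "P * second_kind_numerator A1 B1 C1 P T1 1 - pderiv P * A1 * T1 = 0"
  then have G: "P * S 1 - pderiv P * A1 * T1 = 0" by (simp add: S_def)
  then have 1: "P * S 1 = pderiv P * A1 * T1" by simp
  have 2: "P * S 2 = pderiv (pderiv P) * A1^2 * T1"
    using first_wronskian_derivative[of 0] G by (simp add: S_def)
  have S0: "S 0 = T1" by (simp add: S_def)
  let ?c = "scaled_numerator A2 B2 C2 P T2 2"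
  have "P * R = P * row_det (\<lambda>k. (pderiv ^^ k) P) (\<lambda>k. A1^(2-k) * S k) ?c 0 1 2"
    by (simp add: R_def D_def scaled_numerator_def[abs_def] S_def)
  also have "\<dots> = row_det (\<lambda>k. (pderiv ^^ k) P) (\<lambda>k. A1^(2-k) * (P * S k)) ?c 0 1 2"
    by (simp add: row_det_def algebra_simps)
  also have "\<dots> = 0"
        by (simp add: row_det_def 1[unfolded One_nat_def] 2 S0) (simp add: eval_nat_numeral algebra_simps)
  finally show False using assms by simp
qed


lemma degree_bound_E:
  assumes A1: "A1 \<noteq> 0" and A2: "A2 \<noteq> 0" and P: "P \<noteq> 0" and R: "R \<noteq> 0"
    and s1: "s1 \<ge> 0" "int (degree A1) \<le> s1 + 2" "int (degree B1) \<le> s1 + 1"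
    and s2: "s2 \<ge> 0" "int (degree A2) \<le> s2 + 2" "int (degree B2) \<le> s2 + 1"
  shows "int (degree E) \<le>
     max (int (degree A1) + s2) (max (int (degree A2) + s1) (int (degree B1) + int (degree B2)))
       + int (degree R)" (is "_ \<le> ?m + _")
proof -
  define G where "G = P * second_kind_numerator A1 B1 C1 P T1 1 - pderiv P * A1 * T1"
  define G1 where "G1 = A1 * pderiv G - (pderiv A1 + B1) * G"
  have G: "G \<noteq> 0" unfolding G_def by (rule first_wronskian_nonzero[OF A1 P R])
  let ?d = "\<lambda>p. int (degree p)"
  define \<mu> where "\<mu> = max (?d A1 - 1) (?d B1)"
  have m: "?d A2 - 1 + \<mu> \<le> ?m" "?d B2 + \<mu> \<le> ?m" "?d A1 + ?d A2 - 2 \<le> ?m" and m0: "0 \<le> ?m"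
    using s1 s2 by (auto simp: \<mu>_def)
  have dA1: "degree_le (pderiv A1) \<mu>" and dB1: "degree_le B1 \<mu>"
    by (rule degree_le_mono[OF degree_le_pderiv[OF degree_le_degree]], simp add: \<mu>_def)
       (rule degree_le_mono[OF degree_le_degree], simp add: \<mu>_def)
  have "degree_le G1 (?d G + \<mu>)"
    unfolding G1_def
  proof (intro degree_le_add degree_le_diff)
    show "degree_le (A1 * pderiv G) (?d G + \<mu>)"
      by (rule degree_le_mono[OF degree_le_mult[OF degree_le_degree degree_le_pderiv[OF degree_le_degree]]])
         (simp add: \<mu>_def)
    show "degree_le ((pderiv A1 + B1) * G) (?d G + \<mu>)"
      by (rule degree_le_mono[OF degree_le_mult[OF degree_le_add[OF dA1 dB1] degree_le_degree]]) simp
  qed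
  note dG1 = this
  note ds = dG1 degree_le_mult degree_le_pderiv degree_le_degree
  have "degree_le (E * G * P) (?d P + ?d G + ?d R + ?m)"
    unfolding E_factorisation[OF A1 G_def G1_def] distrib_left distrib_right right_diff_distrib minus_add_distrib
  proof (intro degree_le_add degree_le_diff degree_le_minus)
    show "degree_le (P * (A2 * R * pderiv G1)) (?d P + ?d G + ?d R + ?m)"
      by (rule degree_le_mono, (rule ds)+) (use m in simp)
    show "degree_le (P * (2 * pderiv A2 * R * G1)) (?d P + ?d G + ?d R + ?m)"
      unfolding mult_2 distrib_right distrib_left
      by (intro degree_le_add; rule degree_le_mono, (rule ds)+) (use m in simp_all)
    show "degree_le (P * (B2 * R * G1)) (?d P + ?d G + ?d R + ?m)"
      by (rule degree_le_mono, (rule ds)+) (use m in simp)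
    show "degree_le (P * (A2 * pderiv R * G1)) (?d P + ?d G + ?d R + ?m)"
      by (rule degree_le_mono, (rule ds)+) (use m in simp)
    show "degree_le (A2 * R * (A1 * pderiv (pderiv P) * G)) (?d P + ?d G + ?d R + ?m)"
      by (rule degree_le_mono, (rule ds)+) (use m in simp)
    show "degree_le (A2 * R * (pderiv P * G1)) (?d P + ?d G + ?d R + ?m)"
      by (rule degree_le_mono, (rule ds)+) (use m in simp)
  qed
  then have "degree_le E (?m + ?d R)"
    using G P by (intro degree_le_cancel[of E G] degree_le_cancel[of "E * G" P]) (simp_all add: add_ac)
  then show ?thesis using m0 by (auto simp: degree_le_def)
qed

text \<open>
  \<open>F P\<close> is determined by the other terms of the differential equation of \<open>P\<close>, where each derivative
  of \<open>P\<close> compensates the larger degree of its coefficient.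
\<close>

lemma degree_bound_F:
  assumes A1: "A1 \<noteq> 0" and A2: "A2 \<noteq> 0" and P: "P \<noteq> 0" and R: "R \<noteq> 0"
    and s1: "s1 \<ge> 0" "int (degree A1) \<le> s1 + 2" "int (degree B1) \<le> s1 + 1"
    and s2: "s2 \<ge> 0" "int (degree A2) \<le> s2 + 2" "int (degree B2) \<le> s2 + 1"
  shows "int (degree F) \<le> s1 + s2 + int (degree R) + 1" (is "_ \<le> ?m")
proof -
  let ?d = "\<lambda>p. int (degree p)"
  have dE: "degree_le E (s1 + s2 + 2 + ?d R)"
    using degree_bound_E[OF assms] s1 s2 by (auto simp: degree_le_def)
  have dA: "degree_le A1 (s1 + 2)" "degree_le A2 (s2 + 2)" and dB: "degree_le B1 (s1 + 1)" "degree_le B2 (s2 + 1)"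
    using s1 s2 by (auto simp: degree_le_def)
  note ds = dA dB degree_le_mult degree_le_pderiv degree_le_degree
  have dc3: "degree_le c3 (s1 + s2 + 4 + ?d R)"
    unfolding c3_def by (rule degree_le_mono, (rule ds)+) simp
  have dc2: "degree_le c2 (s1 + s2 + 3 + ?d R)"
    unfolding c2_def mult_2 distrib_left distrib_right
    by (intro degree_le_add degree_le_diff; rule degree_le_mono, (rule ds)+) simp_all
  have dP: "degree_le ((pderiv ^^ k) P) (?d P - int k)" for k
    by (induction k) (auto intro: degree_le_degree dest: degree_le_pderiv simp: algebra_simps)
  have "F * P = - (c3 * (pderiv ^^ 3) P + c2 * (pderiv ^^ 2) P + E * (pderiv ^^ 1) P)"
    using minus_unique[OF ode_P] by simp
  also have "degree_le \<dots> (?d P + ?m)"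
    by (intro degree_le_add degree_le_minus;
        rule degree_le_mono[OF degree_le_mult[OF _ dP]], rule dc3 dc2 dE) simp_all
  finally have "degree_le F ?m"
    using P by (intro degree_le_cancel[of F P]) (simp_all add: add_ac)
  then show ?thesis using s1 s2 by (auto simp: degree_le_def)
qed

section \<open>Determinants of two equal weights\<close>

text \<open>
  The quotient \<open>R/A\<^sup>2\<close> for equal weights.
\<close>

definition equal_weight_core :: "'a poly" where
  "equal_weight_core =
     (let S = second_kind_numerator A1 B1 C1 P T1; S' = second_kind_numerator A1 B1 C2 P T2;
          X = pderiv P * C1 + pderiv (S 1); X' = pderiv P * C2 + pderiv (S' 1)
      in P * (S 1 * X' - X * S' 1) - pderiv P * (T1 * S' 2 - S 2 * T2)
         + pderiv (pderiv P) * A1 * (T1 * S' 1 - S 1 * T2))"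

text \<open>
  Modulo \<open>A1\<close> the numerators \<open>S_2\<close> are multiples of \<open>S_1\<close> by the same factor \<open>- (A1' + B1)\<close> in both
  columns. So the only minor whose scaling contributes a single factor \<open>A1\<close> is itself divisible by
  \<open>A1\<close>.
\<close>

lemma equal_weight_factorisation:
  assumes "A2 = A1" "B2 = B1"
  shows "R = A1\<^sup>2 * equal_weight_core"
proof -
  define b where "b = second_kind_numerator A1 B1 C1 P T1"
  define c where "c = second_kind_numerator A1 B1 C2 P T2"
  define x where "x = pderiv P * C1 + pderiv (b 1)"
  define y where "y = pderiv P * C2 + pderiv (c 1)"
  have 0: "b 0 = T1" "c 0 = T2"
    and 2: "b 2 = A1 * x - (pderiv A1 + B1) * b 1" "c 2 = A1 * y - (pderiv A1 + B1) * c 1"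
    by (simp_all add: b_def c_def x_def y_def numeral_2_eq_2 algebra_simps)
  have R: "R = P * (A1 * (b 1 * c 2 - b 2 * c 1)) - pderiv P * (A1\<^sup>2 * (b 0 * c 2 - b 2 * c 0))
      + pderiv (pderiv P) * (A1\<^sup>2 * A1 * (b 0 * c 1 - b 1 * c 0))"
    unfolding R_def D_def row_det_def scaled_numerator_def unfolding assms b_def[symmetric] c_def[symmetric]
    by (simp add: numeral_2_eq_2 algebra_simps)
  have "b 1 * c 2 - b 2 * c 1 = A1 * (b 1 * y - x * c 1)"
    by (simp add: 2 algebra_simps)
  then show ?thesis
    unfolding R equal_weight_core_def Let_def b_def[symmetric] c_def[symmetric]
      x_def[symmetric] y_def[symmetric] 0
    by (simp only:) (simp add: power2_eq_square algebra_simps)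
qed

text \<open>
  As for \<open>R\<close>, with the rows 2 and 3 in place of 1 and 2.
\<close>

lemma equal_weight_dvd:
  assumes "A2 = A1" "B2 = B1"
  shows "A1\<^sup>2 dvd E" "A1\<^sup>2 dvd F"
proof -
  define b where "b = second_kind_numerator A1 B1 C1 P T1"
  define c where "c = second_kind_numerator A1 B1 C2 P T2"
  define x where "x = A1 * pderiv (pderiv P) * C1 + pderiv (b 2)"
  define y where "y = A1 * pderiv (pderiv P) * C2 + pderiv (c 2)"
  have b3: "b 3 = A1 * x - (2 * pderiv A1 + B1) * b 2"
   and c3: "c 3 = A1 * y - (2 * pderiv A1 + B1) * c 2"
    by (simp_all add: b_def c_def x_def y_def numeral_3_eq_3 numeral_2_eq_2 algebra_simps)
  have 23: "b 2 * c 3 - b 3 * c 2 = A1 * (b 2 * y - x * c 2)"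
    by (simp add: b3 c3 algebra_simps)
  have D: "D 3 i 2 3 = (pderiv ^^ i) P * (A1 * (b 2 * c 3 - b 3 * c 2))
      - (pderiv ^^ 2) P * (A1 ^ (3 - i) * (b i * c 3 - b 3 * c i))
      + (pderiv ^^ 3) P * (A1 ^ (3 - i) * A1 * (b i * c 2 - b 2 * c i))" for i
    unfolding D_def row_det_def scaled_numerator_def unfolding assms b_def[symmetric] c_def[symmetric]
    by (simp add: algebra_simps)
  have "A1\<^sup>2 dvd D 3 i 2 3" if "i \<le> 1" for i
  proof -
    have "A1\<^sup>2 dvd A1 ^ (3 - i)" using that by (intro le_imp_power_dvd) simp
    moreover have "A1\<^sup>2 dvd A1 * (b 2 * c 3 - b 3 * c 2)"
      unfolding 23 power2_eq_square by simp
    ultimately show ?thesis unfolding D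
      by - (intro dvd_add dvd_diff; rule dvd_mult; (assumption | rule dvd_mult2)+)
  qed
  from this[of 0] this[of 1] show "A1\<^sup>2 dvd E" "A1\<^sup>2 dvd F"
    by (simp_all add: E_def F_def)
qed

end

section \<open>Decay of integrable weights at the end points of an interval\<close>

text \<open>
  The integrals over the intervals are at least \<open>\<kappa>\<close>, but tend to 0 by dominated convergence since
  every point leaves the intervals eventually. With intervals that shrink towards a finite end point
  \<open>r\<close> this excludes densities of size \<open>1/|t - r|\<close>; with unit intervals that run off to infinity it
  excludes densities bounded away from 0.
\<close>

lemma escaping_intervals_not_integrable:
  fixes f :: "real \<Rightarrow> real"
  assumes f: "set_integrable lborel I f" and \<kappa>: "\<kappa> > 0"
    and lu: "\<And>n::nat. l n < u n" and sub: "\<And>n. {l n<..<u n} \<subseteq> I"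
    and low: "\<And>n t. t \<in> {l n<..<u n} \<Longrightarrow> \<kappa> / (u n - l n) \<le> f t"
    and esc: "\<And>t. t \<in> I \<Longrightarrow> \<forall>\<^sub>F n in sequentially. t \<notin> {l n<..<u n}"
  shows False
proof -
  define g where "g n t = indicat_real {l n<..<u n} t * (indicat_real I t * f t)" for n t
  have I: "integrable lborel (\<lambda>t. indicat_real I t * f t)"
    using f by (simp add: set_integrable_def)
  have [measurable]: "(\<lambda>t. indicat_real I t * f t) \<in> borel_measurable lborel"
    by (rule borel_measurable_integrable[OF I])
  have "(\<lambda>n. integral\<^sup>L lborel (g n)) \<longlonglongrightarrow> integral\<^sup>L lborel (\<lambda>t::real. 0::real)"
  proof (rule integral_dominated_convergence[where w = "\<lambda>t. norm (indicat_real I t * f t)"])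
    show "AE t in lborel. (\<lambda>n. g n t) \<longlonglongrightarrow> 0"
    proof (rule AE_I2)
      fix t
      have "\<forall>\<^sub>F n in sequentially. g n t = 0"
        using esc[of t] by (cases "t \<in> I") (auto simp: g_def elim!: eventually_mono)
      then show "(\<lambda>n. g n t) \<longlonglongrightarrow> 0" by (rule tendsto_eventually)
    qed
    show "AE t in lborel. norm (g n t) \<le> norm (indicat_real I t * f t)" for n
      by (simp add: g_def indicator_def)
    show "g n \<in> borel_measurable lborel" for n unfolding g_def by measurable
  qed (use I in auto)
  moreover have "\<kappa> \<le> integral\<^sup>L lborel (g n)" for n
  proof -
    have "\<kappa> = (\<integral>t. indicat_real {l n<..<u n} t * (\<kappa> / (u n - l n)) \<partial>lborel)"
      using lu[of n] by simp
    also have "\<dots> \<le> integral\<^sup>L lborel (g n)"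
    proof (rule integral_mono)
      show "integrable lborel (\<lambda>t. indicat_real {l n<..<u n} t * (\<kappa> / (u n - l n)))"
        using lu[of n] by (intro integrable_mult_left) (simp_all add: integrable_indicator_iff)
      show "integrable lborel (g n)"
      proof (rule Bochner_Integration.integrable_bound[OF I])
        show "g n \<in> borel_measurable lborel" unfolding g_def by measurable
      qed (simp add: g_def indicator_def)
      show "indicat_real {l n<..<u n} t * (\<kappa> / (u n - l n)) \<le> g n t" for t
        using low[of t n] sub[of n] by (auto simp: g_def indicator_def)
    qed
    finally show ?thesis .
  qed
  ultimately have "\<kappa> \<le> 0"
    by (intro LIMSEQ_le_const[of "\<lambda>n. integral\<^sup>L lborel (g n)"]) auto
  with \<kappa> show False by simp
qed

lemma poly_zero_linear_bound:
  fixes A :: "real poly"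
  assumes "poly A r = 0"
  obtains K where "K > 0" "\<And>t. \<bar>t - r\<bar> \<le> d \<Longrightarrow> \<bar>poly A t\<bar> \<le> K * \<bar>t - r\<bar>"
proof -
  obtain C where C: "A = [:-r, 1:] * C" using assms by (auto simp: poly_eq_0_iff_dvd dvd_def)
  have "bounded (poly C ` cball r d)"
    by (intro compact_imp_bounded compact_continuous_image continuous_intros) auto
  then obtain K where K: "K > 0" "\<And>t. t \<in> cball r d \<Longrightarrow> \<bar>poly C t\<bar> \<le> K"
    by (auto simp: bounded_pos)
  have "\<bar>poly A t\<bar> \<le> K * \<bar>t - r\<bar>" if "\<bar>t - r\<bar> \<le> d" for t
  proof -
    have "poly A t = poly C t * (t - r)" by (simp add: C algebra_simps)
    then show ?thesis
      using K(2)[of t] that by (simp add: abs_mult dist_real_def abs_minus_commute mult_right_mono)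
  qed
  with K(1) that show ?thesis by blast
qed

text \<open>
  This form of \<open>A \<rho> \<rightarrow> 0\<close> suffices for the boundary terms of a partial integration. If \<open>|A \<rho>| \<ge> \<epsilon>\<close> near the
  end point, then \<open>A \<rho>\<close> itself is not integrable when the end point is infinite; at a finite end point
  \<open>r\<close>, where \<open>A(r) = 0\<close>, the weight is at least a multiple of \<open>1/|t - r|\<close>.
\<close>

lemma small_near_left_end:
  fixes A :: "real poly" and \<rho> :: "real \<Rightarrow> real"
  assumes a: "a = -\<infinity> \<or> (\<exists>r. a = ereal r \<and> poly A r = 0)"
    and int: "set_integrable lborel (einterval a b) (\<lambda>t. \<bar>\<rho> t\<bar>)"
             "set_integrable lborel (einterval a b) (\<lambda>t. \<bar>poly A t * \<rho> t\<bar>)"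
    and c: "c \<in> einterval a b" and \<epsilon>: "\<epsilon> > 0"
  shows "\<exists>t\<in>einterval a b. t < c \<and> \<bar>poly A t * \<rho> t\<bar> < \<epsilon>"
proof (rule ccontr)
  assume "\<not> ?thesis"
  then have big: "\<epsilon> \<le> \<bar>poly A t * \<rho> t\<bar>" if "t \<in> einterval a b" "t < c" for t
    using that by force
  from a show False
  proof (elim disjE exE conjE)
    assume a: "a = -\<infinity>"
    have sub: "{c - real n - 1<..<c - real n} \<subseteq> einterval a b" for n
    proof
      fix t assume "t \<in> {c - real n - 1<..<c - real n}"
      then have "ereal t < ereal c" by simp
      also have "\<dots> < b" using c by (simp add: einterval_iff)
      finally show "t \<in> einterval a b" by (simp add: a einterval_iff)
    qed
    show False
    proof (rule escaping_intervals_not_integrable[OF int(2) \<epsilon> _ sub])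
      fix t :: real
      obtain N where N: "c - t < real N" using reals_Archimedean2 by blast
      show "\<forall>\<^sub>F n in sequentially. t \<notin> {c - real n - 1<..<c - real n}"
        using eventually_ge_at_top[of N] by eventually_elim (use N in auto)
    next
      fix n t assume "t \<in> {c - real n - 1<..<c - real n}"
      then show "\<epsilon> / (c - real n - (c - real n - 1)) \<le> \<bar>poly A t * \<rho> t\<bar>"
        using big[of t] sub[of n] by (simp add: subset_iff)
    qed simp
  next
    fix r assume r: "a = ereal r" "poly A r = 0"
    obtain K where K: "K > 0" "\<And>t. \<bar>t - r\<bar> \<le> c - r \<Longrightarrow> \<bar>poly A t\<bar> \<le> K * \<bar>t - r\<bar>"
      using poly_zero_linear_bound[OF r(2)] by metis
    have rc: "r < c" using c by (simp add: r einterval_iff)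
      \<comment> \<open>The intervals \<open>(r + h, r + 2 h)\<close> have length comparable to their distance from \<open>r\<close>, so the
      integral of \<open>1/|t - r|\<close> over each of them is bounded below.\<close>
    define h where "h n = (c - r) / (2 * real (Suc n))" for n
    have h: "0 < h n" "2 * h n \<le> c - r" for n
      using rc by (auto simp: h_def field_simps mult_right_mono)
    have sub: "{r + h n<..<r + 2 * h n} \<subseteq> einterval a b" for n
    proof
      fix t assume t: "t \<in> {r + h n<..<r + 2 * h n}"
      then have "ereal t < ereal c" using h[of n] by simp
      also have "\<dots> < b" using c by (simp add: einterval_iff)
      finally show "t \<in> einterval a b" using t h[of n] by (simp add: r einterval_iff)
    qed
    show False
    proof (rule escaping_intervals_not_integrable[OF int(1) _ _ sub])
      show "0 < \<epsilon> / (2 * K)" using \<epsilon> K by simp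
      show "r + h n < r + 2 * h n" for n using h[of n] by simp
      fix t assume "t \<in> einterval a b"
      then have "r < t" by (simp add: r einterval_iff)
      obtain N where N: "(c - r) / (t - r) < real N" using reals_Archimedean2 by blast
      show "\<forall>\<^sub>F n in sequentially. t \<notin> {r + h n<..<r + 2 * h n}"
        using eventually_ge_at_top[of N]
      proof eventually_elim
        case (elim n)
        then have "(c - r) / (t - r) < real (Suc n)" using N by simp
        then have "2 * h n < t - r" using \<open>r < t\<close> by (simp add: h_def field_simps)
        then show ?case by auto
      qed
    next
      fix n t assume t: "t \<in> {r + h n<..<r + 2 * h n}"
      have "\<epsilon> \<le> \<bar>poly A t\<bar> * \<bar>\<rho> t\<bar>" using big[of t] subsetD[OF sub t] t h[of n] by (simp add: abs_mult)
      also have "\<dots> \<le> (K * \<bar>t - r\<bar>) * \<bar>\<rho> t\<bar>" using K(2)[of t] t h[of n] by (intro mult_right_mono) auto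
      also have "\<dots> \<le> (K * (2 * h n)) * \<bar>\<rho> t\<bar>" using K(1) t h[of n] by (intro mult_right_mono) auto
      finally show "\<epsilon> / (2 * K) / (r + 2 * h n - (r + h n)) \<le> \<bar>\<rho> t\<bar>"
        using K(1) h[of n] by (simp add: field_simps)
    qed
  qed
qed

lemma small_near_right_end:
  fixes A :: "real poly" and \<rho> :: "real \<Rightarrow> real"
  assumes b: "b = \<infinity> \<or> (\<exists>r. b = ereal r \<and> poly A r = 0)"
    and int: "set_integrable lborel (einterval a b) (\<lambda>t. \<bar>\<rho> t\<bar>)"
             "set_integrable lborel (einterval a b) (\<lambda>t. \<bar>poly A t * \<rho> t\<bar>)"
    and c: "c \<in> einterval a b" and \<epsilon>: "\<epsilon> > 0"
  shows "\<exists>t\<in>einterval a b. c < t \<and> \<bar>poly A t * \<rho> t\<bar> < \<epsilon>"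
proof -
  have mem: "t \<in> einterval (- b) (- a) \<longleftrightarrow> - t \<in> einterval a b" for t
    by (auto simp: einterval_iff ereal_uminus_less_reorder ereal_less_uminus_reorder simp flip: uminus_ereal.simps)
  have refl: "set_integrable lborel (einterval (- b) (- a)) (\<lambda>t. f (- t))"
    if "set_integrable lborel (einterval a b) f" for f :: "real \<Rightarrow> real"
  proof -
    have "integrable lborel (\<lambda>t. indicat_real (einterval a b) (0 + (-1) * t) *\<^sub>R f (0 + (-1) * t))"
      using that unfolding set_integrable_def by (rule lborel_integrable_real_affine) simp
    then show ?thesis
      unfolding set_integrable_def by (simp add: indicator_def mem)
  qed
  let ?A = "pcompose A [:0, -1:]"
  have "\<exists>t\<in>einterval (- b) (- a). t < - c \<and> \<bar>poly ?A t * \<rho> (- t)\<bar> < \<epsilon>"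
  proof (rule small_near_left_end)
    show "- b = - \<infinity> \<or> (\<exists>r. - b = ereal r \<and> poly ?A r = 0)"
      using b by (auto simp: poly_pcompose)
    show "set_integrable lborel (einterval (- b) (- a)) (\<lambda>t. \<bar>\<rho> (- t)\<bar>)"
      using refl[OF int(1)] .
    show "set_integrable lborel (einterval (- b) (- a)) (\<lambda>t. \<bar>poly ?A t * \<rho> (- t)\<bar>)"
      using refl[OF int(2)] by (simp add: poly_pcompose)
  qed (use c \<epsilon> in \<open>simp_all add: mem\<close>)
  then obtain t where "t \<in> einterval (- b) (- a)" "t < - c" "\<bar>poly ?A t * \<rho> (- t)\<bar> < \<epsilon>" by blast
  then show ?thesis by (intro bexI[of _ "- t"]) (auto simp: mem poly_pcompose)
qed

text \<open>
  The points arbitrarily close to the ends at which \<open>F\<close> is small serve as end points of an exhausting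
  sequence of compact intervals; integrability of \<open>f\<close> allows the passage to the limit.
\<close>

lemma integral_of_derivative_eq_0:
  fixes F f :: "real \<Rightarrow> complex"
  assumes ab: "a < b"
    and F: "\<And>x. x \<in> einterval a b \<Longrightarrow> (F has_vector_derivative f x) (at x)"
    and cont: "continuous_on (einterval a b) f"
    and f: "set_integrable lborel (einterval a b) f"
    and left: "\<And>c \<epsilon>. c \<in> einterval a b \<Longrightarrow> \<epsilon> > 0 \<Longrightarrow> \<exists>t\<in>einterval a b. t < c \<and> norm (F t) < \<epsilon>"
    and right: "\<And>c \<epsilon>. c \<in> einterval a b \<Longrightarrow> \<epsilon> > 0 \<Longrightarrow> \<exists>t\<in>einterval a b. c < t \<and> norm (F t) < \<epsilon>"
  shows "(LINT x:einterval a b|lborel. f x) = 0"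
proof -
  obtain u l :: "nat \<Rightarrow> real" where
    ul: "einterval a b = (\<Union>i. {l i .. u i})"
    "incseq u" "decseq l" "\<And>i. l i < u i" "\<And>i. a < l i" "\<And>i. u i < b"
    by (blast intro: einterval_Icc_approximation[OF ab])
  have mem: "l n \<in> einterval a b" "u n \<in> einterval a b" for n
    using ul(4)[of n] unfolding ul(1) by (auto intro!: exI[of _ n])
  have "\<forall>n. \<exists>t\<in>einterval a b. t < l n \<and> norm (F t) < 1 / real (Suc n)"
    by (intro allI left mem) simp
  then obtain l' where l': "\<And>n. l' n \<in> einterval a b" "\<And>n. l' n < l n" "\<And>n. norm (F (l' n)) < 1 / real (Suc n)"
    by metis
  have "\<forall>n. \<exists>t\<in>einterval a b. u n < t \<and> norm (F t) < 1 / real (Suc n)"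
    by (intro allI right mem) simp
  then obtain u' where u': "\<And>n. u' n \<in> einterval a b" "\<And>n. u n < u' n" "\<And>n. norm (F (u' n)) < 1 / real (Suc n)"
    by metis
  have lu: "l' n < u' n" for n using l'(2)[of n] u'(2)[of n] ul(4)[of n] by simp
  have sub: "{l' n..u' n} \<subseteq> einterval a b" for n
  proof
    fix x assume "x \<in> {l' n..u' n}"
    then have "ereal (l' n) \<le> ereal x" "ereal x \<le> ereal (u' n)" by simp_all
    then show "x \<in> einterval a b"
      using l'(1)[of n] u'(1)[of n] unfolding einterval_iff by (metis less_le_trans le_less_trans)
  qed
  have FTC: "(LINT x:{l' n..u' n}|lborel. f x) = F (u' n) - F (l' n)" for n
    unfolding set_lebesgue_integral_def
  proof (rule integral_FTC_atLeastAtMost)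
    show "continuous_on {l' n..u' n} f" by (rule continuous_on_subset[OF cont sub])
    show "(F has_vector_derivative f x) (at x within {l' n..u' n})" if "l' n \<le> x" "x \<le> u' n" for x
      using that sub[of n] by (intro has_vector_derivative_at_within[OF F]) auto
  qed (use lu[of n] in simp)
  have "(\<lambda>n. 1 / real (Suc n)) \<longlonglongrightarrow> 0" by (rule LIMSEQ_Suc) (rule lim_1_over_n)
  then have "(\<lambda>n. F (l' n)) \<longlonglongrightarrow> 0" "(\<lambda>n. F (u' n)) \<longlonglongrightarrow> 0"
    by (rule Lim_null_comparison[rotated], intro always_eventually allI less_imp_le l'(3) u'(3))+
  then have "(\<lambda>n. F (u' n) - F (l' n)) \<longlonglongrightarrow> 0 - 0" by (intro tendsto_diff)
  then have 1: "(\<lambda>n. LINT x:{l' n..u' n}|lborel. f x) \<longlonglongrightarrow> 0" by (simp add: FTC)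
  have I: "integrable lborel (\<lambda>x. indicat_real (einterval a b) x *\<^sub>R f x)"
    using f by (simp add: set_integrable_def)
  have [measurable]: "(\<lambda>x. indicat_real (einterval a b) x *\<^sub>R f x) \<in> borel_measurable lborel"
    by (rule borel_measurable_integrable[OF I])
  have "(\<lambda>n. \<integral>x. indicat_real {l' n..u' n} x *\<^sub>R (indicat_real (einterval a b) x *\<^sub>R f x) \<partial>lborel)
      \<longlonglongrightarrow> (\<integral>x. indicat_real (einterval a b) x *\<^sub>R f x \<partial>lborel)"
  proof (rule integral_dominated_convergence[where w = "\<lambda>x. norm (indicat_real (einterval a b) x *\<^sub>R f x)"])
    show "AE x in lborel. (\<lambda>n. indicat_real {l' n..u' n} x *\<^sub>R (indicat_real (einterval a b) x *\<^sub>R f x))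
            \<longlonglongrightarrow> indicat_real (einterval a b) x *\<^sub>R f x"
    proof (rule AE_I2)
      fix x
      show "(\<lambda>n. indicat_real {l' n..u' n} x *\<^sub>R (indicat_real (einterval a b) x *\<^sub>R f x))
            \<longlonglongrightarrow> indicat_real (einterval a b) x *\<^sub>R f x"
      proof (cases "x \<in> einterval a b")
        case True
        then obtain i where i: "l i \<le> x" "x \<le> u i" unfolding ul(1) by auto
        have "\<forall>\<^sub>F n in sequentially. x \<in> {l' n..u' n}"
          using eventually_ge_at_top[of i]
        proof eventually_elim
          case (elim n)
          then show ?case
            using i l'(2)[of n] u'(2)[of n] incseqD[OF ul(2) elim] decseqD[OF ul(3) elim] by auto
        qed
        then show ?thesis by (intro tendsto_eventually) (auto elim!: eventually_mono)
      qed auto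
    qed
    show "AE x in lborel. norm (indicat_real {l' n..u' n} x *\<^sub>R (indicat_real (einterval a b) x *\<^sub>R f x))
         \<le> norm (indicat_real (einterval a b) x *\<^sub>R f x)" for n
      by (simp add: indicator_def)
    show "(\<lambda>x. indicat_real {l' n..u' n} x *\<^sub>R (indicat_real (einterval a b) x *\<^sub>R f x)) \<in> borel_measurable lborel" for n
      by measurable
    show "integrable lborel (\<lambda>x. norm (indicat_real (einterval a b) x *\<^sub>R f x))" by (rule integrable_norm[OF I])
  qed measurable
  moreover have "indicat_real {l' n..u' n} x *\<^sub>R (indicat_real (einterval a b) x *\<^sub>R f x) =
      indicat_real {l' n..u' n} x *\<^sub>R f x" for n x
    using sub[of n] by (auto simp: indicator_def)
  ultimately have 2: "(\<lambda>n. LINT x:{l' n..u' n}|lborel. f x) \<longlonglongrightarrow> (LINT x:einterval a b|lborel. f x)"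
    unfolding set_lebesgue_integral_def by (simp only:)
  show ?thesis by (rule LIMSEQ_unique[OF 2 1])
qed

section \<open>Differentiability of the weight\<close>

lemma poly_cpoly_of_real: "poly (cpoly A) (of_real x) = of_real (poly A x)"
  by (induction A) (auto simp: map_poly_pCons)

text \<open>
  Near \<open>x\<close> the function \<open>B/A\<close> has a holomorphic primitive on a full disc, and on the upper half disc, which
  is connected, the given branch is a constant multiple of its exponential. The boundary value
  therefore extends holomorphically across \<open>x\<close>, so that \<open>\<rho>\<close> inherits the differential equation of the
  branch.
\<close>

lemma boundary_value_derivative:
  assumes bv: "boundary_value_on A B I \<rho>" and I: "open I" "x \<in> I" and A: "poly A x \<noteq> 0"
  shows "(\<rho> has_real_derivative poly B x / poly A x * \<rho> x) (at x)"
proof -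
  define H where "H = {z::complex. Im z > 0}"
  obtain U w c where U: "is_branch A B U w" "c \<noteq> 0"
    and lim: "\<And>x. x \<in> I \<Longrightarrow> (w \<longlongrightarrow> c * of_real (\<rho> x)) (at (of_real x) within H)"
    and nb: "\<And>x. x \<in> I \<Longrightarrow> \<exists>e>0. ball (of_real x) e \<inter> H \<subseteq> U"
    using bv unfolding boundary_value_on_def H_def by blast
  obtain \<Phi> where \<Phi>: "\<And>z. z \<in> U \<Longrightarrow> (\<Phi> has_field_derivative poly (cpoly B) z / poly (cpoly A) z) (at z)"
    and w: "\<And>z. z \<in> U \<Longrightarrow> w z = exp (\<Phi> z)"
    using U(1) unfolding is_branch_def by blast
  obtain r1 where r1: "r1 > 0" "ball (of_real x) r1 \<inter> H \<subseteq> U" using nb[OF I(2)] by blast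
  obtain r2 where r2: "r2 > 0" "ball x r2 \<subseteq> I" using I open_contains_ball by blast
  have "open {z. poly (cpoly A) z \<noteq> 0}"
    by (intro open_Collect_neq continuous_intros)
  moreover have "of_real x \<in> {z. poly (cpoly A) z \<noteq> 0}"
    using A by (simp add: poly_cpoly_of_real)
  ultimately obtain r3 where r3: "r3 > 0" "ball (of_real x) r3 \<subseteq> {z. poly (cpoly A) z \<noteq> 0}"
    using open_contains_ball by blast
  define r where "r = min r1 (min r2 r3)"
  have r: "r > 0" "ball (of_real x) r \<inter> H \<subseteq> U" "ball x r \<subseteq> I"
     "\<And>z. z \<in> ball (of_real x) r \<Longrightarrow> poly (cpoly A) z \<noteq> 0"
    using r1 r2 r3 by (auto simp: r_def subset_iff)
  let ?b = "ball (complex_of_real x) r"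
  define g where "g z = poly (cpoly B) z / poly (cpoly A) z" for z
  have "g holomorphic_on ?b" unfolding g_def using r(4) by (auto intro!: holomorphic_intros)
  then obtain \<Psi> where "\<And>z. z \<in> ?b \<Longrightarrow> (\<Psi> has_field_derivative g z) (at z within ?b)"
    using holomorphic_convex_primitive'[of ?b g] by (metis convex_ball open_ball)
  then have \<Psi>: "(\<Psi> has_field_derivative g z) (at z)" if "z \<in> ?b" for z
    using at_within_open[OF that open_ball] that by metis
  have "convex (?b \<inter> H)"
    unfolding H_def by (intro convex_Int convex_ball convex_halfspace_Im_gt)
  then have "\<exists>k. \<forall>z\<in>?b \<inter> H. \<Phi> z - \<Psi> z = k"
  proof (rule has_field_derivative_zero_constant)
    fix z assume "z \<in> ?b \<inter> H"
    then have "((\<lambda>z. \<Phi> z - \<Psi> z) has_field_derivative g z - g z) (at z)"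
      using \<Phi>[of z] \<Psi>[of z] r(2) unfolding g_def by (intro DERIV_diff) auto
    then show "((\<lambda>z. \<Phi> z - \<Psi> z) has_field_derivative 0) (at z within ?b \<inter> H)"
      by (simp add: has_field_derivative_at_within)
  qed
  then obtain k where k: "\<And>z. z \<in> ?b \<inter> H \<Longrightarrow> \<Phi> z - \<Psi> z = k" by blast
  \<comment> \<open>Both sides are limits of the branch at \<open>t\<close> from the upper half plane.\<close>
  have \<rho>: "of_real (\<rho> t) = exp k / c * exp (\<Psi> (of_real t))" if t: "t \<in> ball x r" for t
  proof -
    have tb: "complex_of_real t \<in> ?b" using t by (simp add: dist_of_real)
    have "complex_of_real t islimpt H"
      unfolding islimpt_approachable
    proof (intro allI impI)
      fix e :: real assume "e > 0"
      then show "\<exists>z\<in>H. z \<noteq> complex_of_real t \<and> dist z (complex_of_real t) < e"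
        by (intro bexI[of _ "Complex t (e/2)"]) (auto simp: H_def complex_eq_iff dist_norm cmod_def)
    qed
    then have nt: "\<not> trivial_limit (at (complex_of_real t) within H)" by (simp add: trivial_limit_within)
    have "isCont \<Psi> (of_real t)" using \<Psi>[OF tb] by (rule DERIV_isCont)
    then have "((\<lambda>z. exp k * exp (\<Psi> z)) \<longlongrightarrow> exp k * exp (\<Psi> (of_real t))) (at (of_real t) within H)"
      by (intro tendsto_intros) (simp add: continuous_within_subset[OF _ subset_UNIV] flip: continuous_within)
    moreover have "\<forall>\<^sub>F z in at (of_real t) within H. exp k * exp (\<Psi> z) = w z"
      unfolding eventually_at_topological
    proof (intro exI conjI ballI impI)
      fix z assume "z \<in> ?b" "z \<noteq> complex_of_real t" "z \<in> H"
      then have "\<Phi> z = k + \<Psi> z" "z \<in> U" using k[of z] r(2) by (auto simp: algebra_simps)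
      then show "exp k * exp (\<Psi> z) = w z" using w by (simp add: exp_add)
    qed (use tb in auto)
    ultimately have "(w \<longlongrightarrow> exp k * exp (\<Psi> (of_real t))) (at (of_real t) within H)"
      by (rule Lim_transform_eventually)
    then have "c * of_real (\<rho> t) = exp k * exp (\<Psi> (of_real t))"
      using lim[of t] t r(3) by (intro tendsto_unique[OF nt]) auto
    then show ?thesis using U(2) by (simp add: field_simps)
  qed
  have x: "complex_of_real x \<in> ?b" "x \<in> ball x r" using r by auto
  have "((\<lambda>z. exp k / c * exp (\<Psi> z)) has_field_derivative exp k / c * exp (\<Psi> (of_real x)) * g (of_real x)) (at (of_real x))"
    using U(2) by (auto intro!: derivative_eq_intros \<Psi> x)
  then have "((\<lambda>t. exp k / c * exp (\<Psi> (of_real t))) has_vector_derivative exp k / c * exp (\<Psi> (of_real x)) * g (of_real x)) (at x)"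
    by (rule has_vector_derivative_real_field)
  then have "((\<lambda>t. complex_of_real (\<rho> t)) has_vector_derivative of_real (\<rho> x) * g (of_real x)) (at x)"
    unfolding \<rho>[OF x(2), symmetric]
    by (rule has_vector_derivative_transform_within_open[OF _ open_ball x(2)]) (simp add: \<rho>)
  then have "((\<lambda>t. Re (complex_of_real (\<rho> t))) has_vector_derivative Re (of_real (\<rho> x) * g (of_real x))) (at x)"
    by (rule bounded_linear.has_vector_derivative[OF bounded_linear_Re])
  moreover have "g (of_real x) = of_real (poly B x / poly A x)"
    by (simp add: g_def poly_cpoly_of_real)
  ultimately show ?thesis
    by (simp add: has_real_derivative_iff_has_vector_derivative mult.commute flip: of_real_divide)
qed

section \<open>Cauchy transforms of measures with finite moments\<close>

locale moment_measure =
  fixes M :: "real measure" and \<Delta> :: "real set"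
  assumes sets_M [measurable_cong]: "sets M = sets borel"
    and closed_supp: "closed \<Delta>"
    and AE_supp: "AE t in M. t \<in> \<Delta>"
    and moments: "\<And>k. integrable M (\<lambda>t. complex_of_real t ^ k)"
begin

definition cauchy_transform :: "complex poly \<Rightarrow> complex \<Rightarrow> complex" where
  "cauchy_transform p z = (\<integral>t. poly p (of_real t) / (of_real t - z) \<partial>M)"

lemma poly_measurable [measurable]: "(\<lambda>t. poly p (complex_of_real t)) \<in> borel_measurable M"
proof -
  have "continuous_on UNIV (\<lambda>t. poly p (complex_of_real t))" by (intro continuous_intros)
  then show ?thesis unfolding measurable_cong_sets[OF sets_M refl]
    by (rule borel_measurable_continuous_onI)
qed

lemma integrable_poly: "integrable M (\<lambda>t. poly p (complex_of_real t))"
  unfolding poly_altdef by (intro Bochner_Integration.integrable_sum integrable_mult_right moments)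

lemma open_off_support: "open (- complex_of_real ` \<Delta>)"
  using closed_injective_linear_image[OF closed_supp, of complex_of_real]
  by (auto simp: linear_of_real inj_on_def open_Compl)

lemma support_distance:
  fixes z :: complex
  assumes "z \<notin> of_real ` \<Delta>"
  obtains d where "d > 0" "AE t in M. d \<le> norm (of_real t - z)"
proof -
  have "closed (complex_of_real ` \<Delta>)"
    using open_off_support by (simp add: closed_open)
  then obtain d where d: "d > 0" "\<And>y. y \<in> of_real ` \<Delta> \<Longrightarrow> d \<le> dist z y"
    using separate_point_closed[of "of_real ` \<Delta>" z] assms by blast
  have "AE t in M. d \<le> norm (of_real t - z)"
    using AE_supp
  proof eventually_elim
    case (elim t)
    then show ?case using d(2)[of "of_real t"] by (simp add: dist_norm norm_minus_commute)
  qed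
  with d(1) that show ?thesis by blast
qed

lemma integrable_cauchy_kernel:
  fixes z :: complex
  assumes z: "z \<notin> of_real ` \<Delta>"
  shows "integrable M (\<lambda>t. poly p (of_real t) / (of_real t - z) ^ k)"
proof -
  obtain d where d: "d > 0" "AE t in M. d \<le> norm (of_real t - z)" using support_distance[OF z] .
  have "AE t in M. norm (poly p (of_real t) / (of_real t - z) ^ k) \<le> norm (poly p (complex_of_real t) / of_real (d ^ k))"
    using d(2)
  proof eventually_elim
    case (elim t)
    then have "d ^ k \<le> norm (of_real t - z) ^ k" using d(1) by (intro power_mono) auto
    moreover have "d ^ k > 0" "of_real t - z \<noteq> 0" using d(1) elim by auto
    ultimately show ?case using d(1)
      by (auto simp: norm_divide norm_power intro!: divide_left_mono mult_pos_pos)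
  qed
  then show ?thesis
    by (intro Bochner_Integration.integrable_bound[OF integrable_divide_zero[OF integrable_poly[of p]]])
       measurable
qed

text \<open>
  The difference quotient differs from the claimed derivative by
  \<open>(y - z) \<integral> p(t)/((t - y)(t - z)\<^sup>2) dM(t)\<close>, and the integral stays bounded as \<open>y\<close> tends to \<open>z\<close>.
\<close>

lemma cauchy_transform_derivative:
  assumes z: "z \<notin> of_real ` \<Delta>"
  shows "(cauchy_transform p has_field_derivative (\<integral>t. poly p (of_real t) / (of_real t - z)\<^sup>2 \<partial>M)) (at z)"
    (is "(_ has_field_derivative ?D) _")
proof -
  let ?F = "cauchy_transform p" and ?f = "\<lambda>t. poly p (complex_of_real t)"
  obtain d where d: "d > 0" "AE t in M. d \<le> norm (of_real t - z)" using support_distance[OF z] .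
  have "\<forall>\<^sub>F y in at z. y \<in> - of_real ` \<Delta> \<inter> ball z (d / 2) - {z}"
    using d(1) z by (intro eventually_at_in_open open_Int open_off_support open_ball) auto
  then have bound: "\<forall>\<^sub>F y in at z. norm ((?F y - ?F z) / (y - z) - ?D) \<le> norm (y - z) * (2 / d ^ 3 * (\<integral>t. norm (?f t) \<partial>M))"
  proof eventually_elim
    case (elim y)
    then have y: "y \<notin> of_real ` \<Delta>" "norm (y - z) < d / 2" "y \<noteq> z" by (auto simp: dist_norm norm_minus_commute)
    have AE: "AE t in M. d \<le> norm (of_real t - z) \<and> d / 2 \<le> norm (of_real t - y)"
      using d(2)
    proof eventually_elim
      case (elim t)
      have "norm (of_real t - z) \<le> norm (of_real t - y) + norm (y - z)"
        using norm_triangle_ineq[of "of_real t - y" "y - z"] by simp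
      then show ?case using elim y(2) by simp
    qed
    have int: "integrable M (\<lambda>t. ?f t / (of_real t - y))" "integrable M (\<lambda>t. ?f t / (of_real t - z))"
        "integrable M (\<lambda>t. ?f t / (of_real t - z)\<^sup>2)"
      using integrable_cauchy_kernel[OF y(1), of p 1] integrable_cauchy_kernel[OF z, of p 1]
         integrable_cauchy_kernel[OF z, of p 2] by simp_all
    define g where "g = (\<lambda>t. (?f t / (of_real t - y) - ?f t / (of_real t - z)) / (y - z) - ?f t / (of_real t - z)\<^sup>2)"
    have ig: "integrable M g"
      unfolding g_def
      by (rule Bochner_Integration.integrable_diff[OF integrable_divide
            [OF Bochner_Integration.integrable_diff[OF int(1) int(2)]] int(3)])
    have "(?F y - ?F z) / (y - z) - ?D = (\<integral>t. g t \<partial>M)"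
      unfolding cauchy_transform_def g_def
      by (simp only: Bochner_Integration.integral_diff integral_divide_zero int
          Bochner_Integration.integrable_diff integrable_divide)
    also have "norm \<dots> \<le> (\<integral>t. norm (g t) \<partial>M)" by (rule integral_norm_bound)
    also have "\<dots> \<le> (\<integral>t. norm (y - z) * (2 / d ^ 3) * norm (?f t) \<partial>M)"
    proof (rule integral_mono_AE)
      show "integrable M (\<lambda>t. norm (g t))" by (rule integrable_norm[OF ig])
      show "integrable M (\<lambda>t. norm (y - z) * (2 / d ^ 3) * norm (?f t))"
        by (intro integrable_mult_right integrable_norm integrable_poly)
      show "AE t in M. norm (g t) \<le> norm (y - z) * (2 / d ^ 3) * norm (?f t)"
        using AE
      proof eventually_elim
        case (elim t)
        then have ne: "of_real t - z \<noteq> 0" "of_real t - y \<noteq> 0" using d(1) by auto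
        have gt: "g t = ?f t * ((1 / (of_real t - y) - 1 / (of_real t - z)) / (y - z) - 1 / (of_real t - z)\<^sup>2)"
          by (simp add: g_def algebra_simps diff_divide_distrib)
        also have "(1 / (of_real t - y) - 1 / (of_real t - z)) / (y - z) = 1 / ((of_real t - y) * (of_real t - z))"
          using ne y(3) by (simp add: divide_simps)
        also have "1 / ((of_real t - y) * (of_real t - z)) - 1 / (of_real t - z)\<^sup>2 = (y - z) / ((of_real t - y) * (of_real t - z)\<^sup>2)"
          using ne by (simp add: divide_simps power2_eq_square)
        finally have "norm (g t) = norm (?f t) * norm (y - z) / (norm (of_real t - y) * norm (of_real t - z) ^ 2)"
          by (simp add: norm_mult norm_divide norm_power)
        also have "\<dots> \<le> norm (?f t) * norm (y - z) / (d / 2 * d ^ 2)"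
          using elim d(1) ne by (intro divide_left_mono mult_mono power_mono mult_pos_pos) auto
        also have "\<dots> = norm (y - z) * (2 / d ^ 3) * norm (?f t)"
          by (simp add: power2_eq_square power3_eq_cube mult_ac)
        finally show ?case .
      qed
    qed
    finally show ?case by (simp add: mult.assoc)
  qed
  have "((\<lambda>y. (?F y - ?F z) / (y - z) - ?D) \<longlongrightarrow> 0) (at z)"
  proof (rule Lim_null_comparison[OF bound])
    have "((\<lambda>y. norm (y - z) * (2 / d ^ 3 * (\<integral>t. norm (?f t) \<partial>M))) \<longlongrightarrow> norm (z - z) * (2 / d ^ 3 * (\<integral>t. norm (?f t) \<partial>M))) (at z)"
      by (intro tendsto_intros)
    then show "((\<lambda>y. norm (y - z) * (2 / d ^ 3 * (\<integral>t. norm (?f t) \<partial>M))) \<longlongrightarrow> 0) (at z)" by simp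
  qed
  then show ?thesis
    unfolding has_field_derivative_iff by (rule LIM_zero_cancel)
qed

text \<open>
  Since \<open>t p(t)/(t - z) = z p(t)/(t - z) + p(t)\<close>.
\<close>

lemma cauchy_transform_times_linear:
  assumes z: "z \<notin> of_real ` \<Delta>"
  shows "cauchy_transform (pCons a p) z =
     a * cauchy_transform 1 z + z * cauchy_transform p z + (\<integral>t. poly p (of_real t) \<partial>M)"
proof -
  obtain d where d: "d > 0" "AE t in M. d \<le> norm (of_real t - z)" using support_distance[OF z] .
  have "cauchy_transform (pCons a p) z =
      (\<integral>t. a * (1 / (of_real t - z)) + z * (poly p (of_real t) / (of_real t - z)) + poly p (of_real t) \<partial>M)"
    unfolding cauchy_transform_def
  proof (rule integral_cong_AE)
    show "AE t in M. poly (pCons a p) (of_real t) / (of_real t - z) =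
        a * (1 / (of_real t - z)) + z * (poly p (of_real t) / (of_real t - z)) + poly p (of_real t)"
      using d(2)
    proof eventually_elim
      case (elim t)
      define u where "u = of_real t - z"
      then have t: "of_real t = u + z" and "u \<noteq> 0" using elim d(1) by auto
      then show ?case unfolding t by (simp add: field_simps)
    qed
  qed measurable
  also have "\<dots> = a * cauchy_transform 1 z + z * cauchy_transform p z + (\<integral>t. poly p (of_real t) \<partial>M)"
    using integrable_cauchy_kernel[OF z, of 1 1] integrable_cauchy_kernel[OF z, of p 1]
    by (simp add: cauchy_transform_def integrable_poly del: times_divide_eq_right)
  finally show ?thesis .
qed

text \<open>
  The polynomial \<open>T\<close> is \<open>\<integral> (p(t) - p(z))/(t - z) dM(t)\<close>, built up coefficient by coefficient.
\<close>

lemma cauchy_transform_split: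
  "\<exists>T. \<forall>z. z \<notin> of_real ` \<Delta> \<longrightarrow> cauchy_transform p z = poly p z * cauchy_transform 1 z + poly T z"
proof (induction p)
  case 0
  show ?case by (rule exI[of _ 0]) (simp add: cauchy_transform_def)
next
  case (pCons a p)
  then obtain T where T: "\<And>z. z \<notin> of_real ` \<Delta> \<Longrightarrow> cauchy_transform p z = poly p z * cauchy_transform 1 z + poly T z"
    by blast
  show ?case
    by (rule exI[of _ "pCons (\<integral>t. poly p (of_real t) \<partial>M) T"])
       (simp add: cauchy_transform_times_linear T algebra_simps)
qed

lemma cauchy_transform_bound:
  assumes "Im z \<noteq> 0"
  shows "norm (cauchy_transform p z) \<le> (\<integral>t. norm (poly p (complex_of_real t)) \<partial>M) / \<bar>Im z\<bar>"
proof -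
  have z: "z \<notin> of_real ` \<Delta>" using assms by auto
  have "norm (cauchy_transform p z) \<le> (\<integral>t. norm (poly p (complex_of_real t) / (of_real t - z)) \<partial>M)"
    unfolding cauchy_transform_def by (rule integral_norm_bound)
  also have "\<dots> \<le> (\<integral>t. norm (poly p (complex_of_real t)) / \<bar>Im z\<bar> \<partial>M)"
  proof (rule integral_mono)
    show "integrable M (\<lambda>t. norm (poly p (complex_of_real t) / (of_real t - z)))"
      using integrable_cauchy_kernel[OF z, of p 1] by (intro integrable_norm) simp
    show "integrable M (\<lambda>t. norm (poly p (complex_of_real t)) / \<bar>Im z\<bar>)"
      by (intro integrable_divide_zero integrable_norm integrable_poly) 
    fix t
    have "\<bar>Im z\<bar> \<le> norm (of_real t - z)"
      using abs_Im_le_cmod[of "of_real t - z"] by simp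
    then show "norm (poly p (complex_of_real t) / (of_real t - z)) \<le> norm (poly p (complex_of_real t)) / \<bar>Im z\<bar>"
      using assms by (auto simp: norm_divide intro!: divide_left_mono mult_pos_pos)
  qed
  finally show ?thesis by simp
qed

text \<open>
  Every vanishing moment gains a factor \<open>1/z\<close> for the Cauchy transform at infinity.
\<close>

lemma cauchy_transform_monom_mult:
  assumes "z \<notin> of_real ` \<Delta>" "\<And>j. j < n \<Longrightarrow> (\<integral>t. of_real t ^ j * poly p (of_real t) \<partial>M) = 0"
  shows "cauchy_transform (monom 1 n * p) z = z ^ n * cauchy_transform p z"
  using assms(2)
proof (induction n)
  case (Suc n)
  have "monom 1 (Suc n) * p = pCons 0 (monom 1 n * p)"
    by (simp add: monom_Suc)
  then have "cauchy_transform (monom 1 (Suc n) * p) z = z * cauchy_transform (monom 1 n * p) z"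
    using Suc.prems[of n] by (simp add: cauchy_transform_times_linear[OF assms(1)] poly_monom)
  with Suc show ?case by simp
qed (simp add: monom_0 one_pCons[symmetric])

end

text \<open>
  The assumption is the weak form of \<open>(A w)' = (A' + B) w\<close>, tested with the Cauchy kernels
  \<open>1/(t - z)\<close> alone.
\<close>

locale pearson_measure = moment_measure +
  fixes A B :: "complex poly"
  assumes pearson: "\<And>z. z \<notin> of_real ` \<Delta> \<Longrightarrow>
    (\<integral>t. poly (pderiv A + B) (of_real t) / (of_real t - z) \<partial>M)
     = (\<integral>t. poly A (of_real t) / (of_real t - z)\<^sup>2 \<partial>M)"
begin

text \<open>
  Up to polynomials, both sides of the weak Pearson equation reduce to the transform of 1: the
  left one as a Cauchy transform of \<open>A' + B\<close>, the right one as the derivative of the Cauchy transform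
  of \<open>A\<close>. The terms with \<open>A'\<close> cancel.
\<close>

lemma stieltjes_ode:
  "\<exists>C. \<forall>z. z \<notin> of_real ` \<Delta> \<longrightarrow>
     poly A z * deriv (cauchy_transform 1) z = poly B z * cauchy_transform 1 z + poly C z"
proof -
  obtain T where T: "\<And>z. z \<notin> of_real ` \<Delta> \<Longrightarrow> cauchy_transform A z = poly A z * cauchy_transform 1 z + poly T z"
    using cauchy_transform_split by blast
  obtain S where S: "\<And>z. z \<notin> of_real ` \<Delta> \<Longrightarrow> cauchy_transform (pderiv A + B) z =
       poly (pderiv A + B) z * cauchy_transform 1 z + poly S z"
    using cauchy_transform_split by blast
  have "poly A z * deriv (cauchy_transform 1) z = poly B z * cauchy_transform 1 z + poly (S - pderiv T) z"
    if z: "z \<notin> of_real ` \<Delta>" for z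
  proof -
    have d1: "(cauchy_transform 1 has_field_derivative deriv (cauchy_transform 1) z) (at z)"
      using cauchy_transform_derivative[OF z, of 1] by (metis DERIV_imp_deriv)
    have "((\<lambda>z. poly A z * cauchy_transform 1 z + poly T z) has_field_derivative
         poly (pderiv A) z * cauchy_transform 1 z + deriv (cauchy_transform 1) z * poly A z + poly (pderiv T) z) (at z)"
      by (intro DERIV_add DERIV_mult poly_DERIV d1)
    then have "(cauchy_transform A has_field_derivative
         poly (pderiv A) z * cauchy_transform 1 z + deriv (cauchy_transform 1) z * poly A z + poly (pderiv T) z) (at z)"
      by (rule has_field_derivative_transform_within_open[OF _ open_off_support]) (use z T in auto)
    from DERIV_unique[OF this cauchy_transform_derivative[OF z]]
    have "poly (pderiv A) z * cauchy_transform 1 z + deriv (cauchy_transform 1) z * poly A z + poly (pderiv T) z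
       = cauchy_transform (pderiv A + B) z"
      unfolding pearson[OF z, symmetric] cauchy_transform_def .
    then show ?thesis unfolding S[OF z] by (simp add: algebra_simps)
  qed
  then show ?thesis by blast
qed

end

section \<open>The measure of a semiclassical weight\<close>

lemma pderiv_cpoly: "pderiv (cpoly A) = cpoly (pderiv A)"
  by (rule poly_eqI) (simp add: coeff_pderiv coeff_map_poly)

text \<open>
  The end points are left out because nothing is known about \<open>\<rho>\<close> there; they form a null set.
\<close>

definition open_support :: "(ereal \<times> ereal) set \<Rightarrow> real set" where
  "open_support J = (\<Union>(a, b)\<in>J. einterval a b)"

definition weight_measure :: "(ereal \<times> ereal) set \<Rightarrow> (real \<Rightarrow> real) \<Rightarrow> real measure" where
  "weight_measure J \<rho> = density lborel (\<lambda>t. ennreal (indicator (open_support J) t * \<rho> t))"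

lemma open_support_subset: "open_support J \<subseteq> Delta J"
proof
  fix t assume "t \<in> open_support J"
  then obtain a b where "(a, b) \<in> J" "a < ereal t" "ereal t < b"
    by (auto simp: open_support_def einterval_iff)
  then show "t \<in> Delta J" by (auto simp: Delta_def intro!: bexI[of _ "(a, b)"])
qed

lemma open_support_measurable [measurable]: "open_support J \<in> sets borel"
  unfolding open_support_def by (intro borel_open open_UN) auto

lemma Delta_diff_open_support: "Delta J - open_support J \<subseteq> real_of_ereal ` (fst ` J \<union> snd ` J)"
proof
  fix t assume t: "t \<in> Delta J - open_support J"
  then obtain a b where J: "(a, b) \<in> J" and ab: "a \<le> ereal t" "ereal t \<le> b"
    by (auto simp: Delta_def)
  have "\<not> (a < ereal t \<and> ereal t < b)"
    using t J by (auto simp: open_support_def einterval_iff)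
  with ab have "a = ereal t \<or> b = ereal t" by auto
  then have "t = real_of_ereal a \<or> t = real_of_ereal b" by auto
  with J show "t \<in> real_of_ereal ` (fst ` J \<union> snd ` J)" by force
qed

lemma closed_Delta:
  assumes "finite J" shows "closed (Delta J)"
  unfolding Delta_def
proof (intro closed_UN assms ballI, clarify)
  fix a b :: ereal
  show "closed {x. a \<le> ereal x \<and> ereal x \<le> b}"
    by (intro closed_Collect_conj closed_Collect_le continuous_intros)
qed

context
  fixes A B :: "real poly" and J :: "(ereal \<times> ereal) set" and \<rho> :: "real \<Rightarrow> real"
  assumes weight: "semiclassical_weight A B J \<rho>"
begin

lemma weight_finite: "finite J"
  using weight by (simp add: semiclassical_weight_def support_intervals_def)

lemma weight_pos: "t \<in> open_support J \<Longrightarrow> \<rho> t > 0"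
  using weight by (force simp: semiclassical_weight_def open_support_def)

lemma weight_density_nonneg: "0 \<le> indicator (open_support J) t * \<rho> t"
  using weight_pos[of t] by (auto simp: indicator_def)

lemma weight_density_measurable [measurable]:
  "(\<lambda>t. indicator (open_support J) t * \<rho> t) \<in> borel_measurable borel"
proof -
  have "set_integrable lborel (Delta J) (\<lambda>t. \<bar>t\<bar> ^ 0 * \<bar>\<rho> t\<bar>)"
    using weight unfolding semiclassical_weight_def by blast
  then have m: "(\<lambda>t. indicator (Delta J) t * \<bar>\<rho> t\<bar>) \<in> borel_measurable borel"
    by (auto simp: set_integrable_def dest: borel_measurable_integrable)
  have "(\<lambda>t. indicator (open_support J) t * \<rho> t) =
      (\<lambda>t. indicator (open_support J) t * (indicator (Delta J) t * \<bar>\<rho> t\<bar>))"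
    using open_support_subset[of J] weight_pos by (force simp: indicator_def fun_eq_iff)
  also have "\<dots> \<in> borel_measurable borel" using m by measurable
  finally show ?thesis .
qed

lemma weight_integral:
  assumes f: "f \<in> borel_measurable borel"
  shows "(LINT t:Delta J|lborel. f t * complex_of_real (\<rho> t)) = integral\<^sup>L (weight_measure J \<rho>) f"
proof -
  have "integral\<^sup>L (weight_measure J \<rho>) f =
      (\<integral>t. (indicator (open_support J) t * \<rho> t) *\<^sub>R f t \<partial>lborel)"
    unfolding weight_measure_def
    by (rule integral_density) (use f weight_density_nonneg weight_density_measurable in auto)
  also have "\<dots> = (\<integral>t. indicator (Delta J) t *\<^sub>R (f t * complex_of_real (\<rho> t)) \<partial>lborel)"
  proof (rule integral_discrete_difference)
    show "countable (real_of_ereal ` (fst ` J \<union> snd ` J))"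
      using weight_finite by (intro countable_finite) auto
    show "(indicator (open_support J) t * \<rho> t) *\<^sub>R f t = indicator (Delta J) t *\<^sub>R (f t * complex_of_real (\<rho> t))"
      if "t \<notin> real_of_ereal ` (fst ` J \<union> snd ` J)" for t
      using that Delta_diff_open_support[of J] open_support_subset[of J]
      by (auto simp: indicator_def scaleR_conv_of_real)
  qed auto
  finally show ?thesis by (simp add: set_lebesgue_integral_def)
qed

lemma weight_integrable:
  fixes f :: "real \<Rightarrow> complex"
  assumes f: "f \<in> borel_measurable borel"
  shows "integrable (weight_measure J \<rho>) f \<longleftrightarrow>
     set_integrable lborel (open_support J) (\<lambda>t. of_real (\<rho> t) * f t)"
  unfolding weight_measure_def set_integrable_def
  by (subst integrable_density)
     (use f weight_density_nonneg weight_density_measurable in \<open>auto simp: scaleR_conv_of_real mult.assoc\<close>)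

lemma weight_moment_measure: "moment_measure (weight_measure J \<rho>) (Delta J)"
proof
  show "sets (weight_measure J \<rho>) = sets borel" by (simp add: weight_measure_def)
  show "closed (Delta J)" by (rule closed_Delta[OF weight_finite])
  show "AE t in weight_measure J \<rho>. t \<in> Delta J"
    unfolding weight_measure_def
    using open_support_subset[of J] by (subst AE_density, measurable) (auto simp: indicator_def)
  fix k
  have "set_integrable lborel (Delta J) (\<lambda>t. \<bar>t\<bar> ^ k * \<bar>\<rho> t\<bar>)"
    using weight unfolding semiclassical_weight_def by blast
  then have *: "integrable lborel (\<lambda>t. indicator (Delta J) t * (\<bar>t\<bar> ^ k * \<bar>\<rho> t\<bar>))"
    by (simp add: set_integrable_def)
  have "integrable lborel (\<lambda>t. complex_of_real (indicator (open_support J) t * \<rho> t) * of_real t ^ k)"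
  proof (rule Bochner_Integration.integrable_bound[OF *])
    show "AE t in lborel. norm (complex_of_real (indicator (open_support J) t * \<rho> t) * of_real t ^ k)
            \<le> norm (indicator (Delta J) t * (\<bar>t\<bar> ^ k * \<bar>\<rho> t\<bar>))"
      using open_support_subset[of J]
      by (auto simp: indicator_def norm_mult norm_power abs_mult power_abs)
  qed (use weight_density_measurable in measurable)
  then show "integrable (weight_measure J \<rho>) (\<lambda>t. complex_of_real t ^ k)"
    by (subst weight_integrable) (simp_all add: set_integrable_def scaleR_conv_of_real mult.assoc)
qed

interpretation moment_measure "weight_measure J \<rho>" "Delta J"
  by (rule weight_moment_measure)

lemma weight_derivative:
  assumes J: "(a, b) \<in> J" and t: "t \<in> einterval a b"
  shows "(\<rho> has_real_derivative poly B t / poly A t * \<rho> t) (at t)" and "poly A t \<noteq> 0"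
proof -
  show A: "poly A t \<noteq> 0"
    using weight J t by (fastforce simp: semiclassical_weight_def support_intervals_def)
  have "boundary_value_on A B (einterval a b) \<rho>"
    using weight J by (force simp: semiclassical_weight_def)
  from boundary_value_derivative[OF this open_einterval t A]
  show "(\<rho> has_real_derivative poly B t / poly A t * \<rho> t) (at t)" .
qed

text \<open>
  The integrand is the derivative of \<open>A \<rho>/(t - z)\<close>.
\<close>

lemma pearson_on_interval:
  assumes J: "(a, b) \<in> J" and z: "z \<notin> of_real ` Delta J"
  defines "h \<equiv> \<lambda>t. of_real (\<rho> t) * (poly (pderiv (cpoly A) + cpoly B) (of_real t) / (of_real t - z)
             - poly (cpoly A) (of_real t) / (of_real t - z)\<^sup>2)"
  shows "set_integrable lborel (einterval a b) h" "(LINT t:einterval a b|lborel. h t) = 0"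
proof -
  let ?I = "einterval a b"
  have sub: "?I \<subseteq> open_support J" using J by (auto simp: open_support_def)
  have ends: "a < b" "a = -\<infinity> \<or> (\<exists>r. a = ereal r \<and> poly A r = 0)" "b = \<infinity> \<or> (\<exists>r. b = ereal r \<and> poly A r = 0)"
    using weight J by (force simp: semiclassical_weight_def support_intervals_def)+
  have ne: "of_real t - z \<noteq> 0" if "t \<in> ?I" for t
    using z sub that open_support_subset[of J] by auto
  obtain d where d: "d > 0" "\<And>t. t \<in> ?I \<Longrightarrow> d \<le> norm (of_real t - z)"
  proof -
    have "closed (complex_of_real ` Delta J)" using open_off_support by (simp add: closed_open)
    then obtain d where d: "d > 0" "\<And>y. y \<in> of_real ` Delta J \<Longrightarrow> d \<le> dist z y"
      using separate_point_closed[of "of_real ` Delta J" z] z by blast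
    have "d \<le> norm (of_real t - z)" if "t \<in> ?I" for t
      using d(2)[of "of_real t"] that sub open_support_subset[of J]
      by (auto simp: dist_norm norm_minus_commute)
    with d(1) that show ?thesis by blast
  qed
  have int: "set_integrable lborel ?I (\<lambda>t. of_real (\<rho> t) * f t)"
    if "integrable (weight_measure J \<rho>) f" "f \<in> borel_measurable borel" for f :: "real \<Rightarrow> complex"
    using that(1) unfolding weight_integrable[OF that(2)] by (rule set_integrable_subset) (use sub in auto)
  have m: "(\<lambda>t. poly p (complex_of_real t) / (complex_of_real t - z) ^ k) \<in> borel_measurable borel" for p k
    using poly_measurable[of p] unfolding measurable_cong_sets[OF sets_M refl] by measurable
  have kernel: "set_integrable lborel ?I (\<lambda>t. of_real (\<rho> t) * (poly p (complex_of_real t) / (of_real t - z) ^ k))" for p k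
    by (intro int integrable_cauchy_kernel z m)
  show h: "set_integrable lborel ?I h"
    using set_integral_diff(1)[OF kernel[of "pderiv (cpoly A) + cpoly B" 1] kernel[of "cpoly A" 2]]
    by (simp add: h_def right_diff_distrib)
  have "poly (cpoly A) \<circ> of_real \<in> borel_measurable borel"
    using m[of "cpoly A" 0] by (simp add: comp_def)
  then have "set_integrable lborel ?I (\<lambda>t. of_real (\<rho> t) * poly (cpoly A) (of_real t))"
    by (intro int integrable_poly) (simp add: comp_def)
  from set_integrable_norm[OF this]
  have intA: "set_integrable lborel ?I (\<lambda>t. \<bar>poly A t * \<rho> t\<bar>)"
    by (simp add: poly_cpoly_of_real norm_mult abs_mult mult.commute)
  have "set_integrable lborel ?I (\<lambda>t. of_real (\<rho> t) * poly 1 (complex_of_real t))"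
    by (intro int integrable_poly) simp
  from set_integrable_norm[OF this] have int\<rho>: "set_integrable lborel ?I (\<lambda>t. \<bar>\<rho> t\<bar>)"
    by simp
  define F where "F t = of_real (poly A t * \<rho> t) * (1 / (complex_of_real t - z))" for t
  have F_small: "norm (F t) < \<epsilon>" if "t \<in> ?I" "\<bar>poly A t * \<rho> t\<bar> < \<epsilon> * d" for t \<epsilon>
  proof -
    have "norm (F t) = \<bar>poly A t * \<rho> t\<bar> / norm (of_real t - z)"
      unfolding F_def by (simp add: norm_mult norm_divide abs_mult)
    also have "\<dots> \<le> \<bar>poly A t * \<rho> t\<bar> / d"
      using d(1) d(2)[OF that(1)] by (intro divide_left_mono mult_pos_pos) auto
    also have "\<dots> < \<epsilon>" using that(2) d(1) by (simp add: field_simps)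
    finally show ?thesis .
  qed
  show "(LINT t:?I|lborel. h t) = 0"
  proof (rule integral_of_derivative_eq_0[where F = F])
    show "a < b" by (rule ends)
    show "set_integrable lborel ?I h" by (rule h)
    show "(F has_vector_derivative h t) (at t)" if t: "t \<in> ?I" for t
    proof -
      have A: "poly A t \<noteq> 0" and \<rho>: "(\<rho> has_real_derivative poly B t / poly A t * \<rho> t) (at t)"
        using weight_derivative[OF J t] by auto
      have "((\<lambda>t. poly A t * \<rho> t) has_real_derivative poly (pderiv A) t * \<rho> t + poly B t / poly A t * \<rho> t * poly A t) (at t)"
        by (intro DERIV_mult poly_DERIV \<rho>)
      then have 1: "((\<lambda>t. complex_of_real (poly A t * \<rho> t)) has_vector_derivative of_real (poly (pderiv A + B) t * \<rho> t)) (at t)"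
        using A by (intro has_vector_derivative_of_real) (simp add: algebra_simps)
      have "((\<lambda>w. 1 / (w - z)) has_field_derivative - (1 / (of_real t - z)\<^sup>2)) (at (of_real t))"
        using ne[OF t] by (auto intro!: derivative_eq_intros simp: power2_eq_square)
      then have 2: "((\<lambda>t. 1 / (of_real t - z)) has_vector_derivative - (1 / (of_real t - z)\<^sup>2)) (at t)"
        by (rule has_vector_derivative_real_field)
      show ?thesis
        using has_vector_derivative_mult[OF 1 2] unfolding F_def[symmetric]
        by (rule has_vector_derivative_eq_rhs)
           (simp add: h_def pderiv_cpoly poly_cpoly_of_real algebra_simps add_divide_distrib)
    qed
    have "continuous_on ?I \<rho>"
      using weight_derivative(1)[OF J] DERIV_isCont continuous_at_imp_continuous_on by blast
    then show "continuous_on ?I h"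
      unfolding h_def using ne by (auto intro!: continuous_intros)
    show "\<exists>t\<in>?I. t < c \<and> norm (F t) < \<epsilon>" if "c \<in> ?I" "\<epsilon> > 0" for c \<epsilon>
      using small_near_left_end[OF ends(2) int\<rho> intA that(1), of "\<epsilon> * d"] that(2) d(1) F_small by auto
    show "\<exists>t\<in>?I. c < t \<and> norm (F t) < \<epsilon>" if "c \<in> ?I" "\<epsilon> > 0" for c \<epsilon>
      using small_near_right_end[OF ends(3) int\<rho> intA that(1), of "\<epsilon> * d"] that(2) d(1) F_small by auto
  qed
qed

lemma weight_pearson_measure: "pearson_measure (weight_measure J \<rho>) (Delta J) (cpoly A) (cpoly B)"
proof (unfold_locales)
  fix z assume z: "z \<notin> complex_of_real ` Delta J"
  let ?p = "\<lambda>t. poly (pderiv (cpoly A) + cpoly B) (of_real t) / (of_real t - z)"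
  let ?q = "\<lambda>t. poly (cpoly A) (of_real t) / (of_real t - z)\<^sup>2"
  define h where "h t = of_real (\<rho> t) * (?p t - ?q t)" for t
  have m: "(\<lambda>t. poly p (complex_of_real t) / (complex_of_real t - z) ^ k) \<in> borel_measurable borel" for p k
    using poly_measurable[of p] unfolding measurable_cong_sets[OF sets_M refl] by measurable
  have int: "integrable (weight_measure J \<rho>) ?p" "integrable (weight_measure J \<rho>) ?q"
    using integrable_cauchy_kernel[OF z, of "pderiv (cpoly A) + cpoly B" 1]
      integrable_cauchy_kernel[OF z, of "cpoly A" 2] by simp_all
  have mp: "?p \<in> borel_measurable borel" "?q \<in> borel_measurable borel"
    using m[of "pderiv (cpoly A) + cpoly B" 1] m[of "cpoly A" 2] by simp_all
  have disj: "disjoint_family_on (\<lambda>(a, b). einterval a b) J"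
    using weight unfolding semiclassical_weight_def support_intervals_def disjoint_family_on_def by fast
  have "(\<integral>t. ?p t \<partial>weight_measure J \<rho>) - (\<integral>t. ?q t \<partial>weight_measure J \<rho>)
      = (\<integral>t. ?p t - ?q t \<partial>weight_measure J \<rho>)"
    using int by (rule Bochner_Integration.integral_diff[symmetric])
  also have "\<dots> = (\<integral>t. (indicator (open_support J) t * \<rho> t) *\<^sub>R (?p t - ?q t) \<partial>lborel)"
    unfolding weight_measure_def
    by (rule integral_density) (use mp weight_density_nonneg weight_density_measurable in auto)
  also have "\<dots> = (\<integral>t. (\<Sum>(a, b)\<in>J. indicator (einterval a b) t *\<^sub>R h t) \<partial>lborel)"
  proof (rule Bochner_Integration.integral_cong[OF refl])
    fix t
    have "indicat_real (open_support J) t = (\<Sum>i\<in>J. indicator (case i of (a, b) \<Rightarrow> einterval a b) t)"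
      unfolding open_support_def by (rule indicator_UN_disjoint[OF weight_finite disj])
    then show "(indicator (open_support J) t * \<rho> t) *\<^sub>R (?p t - ?q t) = (\<Sum>(a, b)\<in>J. indicator (einterval a b) t *\<^sub>R h t)"
      by (simp add: h_def scaleR_conv_of_real case_prod_unfold sum_distrib_right mult.assoc)
  qed
  also have "\<dots> = (\<Sum>(a, b)\<in>J. (\<integral>t. indicator (einterval a b) t *\<^sub>R h t \<partial>lborel))"
    using pearson_on_interval(1)[OF _ z]
    unfolding case_prod_unfold
    by (intro Bochner_Integration.integral_sum) (auto simp: h_def[abs_def] set_integrable_def)
  also have "\<dots> = 0"
    using pearson_on_interval(2)[OF _ z]
    by (intro sum.neutral) (auto simp: h_def[abs_def] set_lebesgue_integral_def)
  finally show "(\<integral>t. ?p t \<partial>weight_measure J \<rho>) = (\<integral>t. ?q t \<partial>weight_measure J \<rho>)" by simp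
qed

lemma weighted_moment_eq:
  "weighted_moment J \<rho> P j = (\<integral>t. of_real t ^ j * poly P (of_real t) \<partial>weight_measure J \<rho>)"
  unfolding weighted_moment_def
  using poly_measurable[of P] unfolding measurable_cong_sets[OF sets_M refl]
  by (intro weight_integral) measurable

lemma second_kind_eq: "second_kind J \<rho> P w z = cauchy_transform P z / w z"
proof -
  have "(LINT t:Delta J|lborel. poly P (of_real t) / (of_real t - z) * of_real (\<rho> t)) = cauchy_transform P z"
    unfolding cauchy_transform_def
    using poly_measurable[of P] unfolding measurable_cong_sets[OF sets_M refl]
    by (intro weight_integral) measurable
  then show ?thesis by (simp add: second_kind_def)
qed

end

section \<open>Functions of the second kind\<close>

lemma is_branch_derivative:
  assumes "is_branch A B D w" "z \<in> D"
  shows "(w has_field_derivative poly (cpoly B) z / poly (cpoly A) z * w z) (at z)"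
    and "w z \<noteq> 0" and "poly (cpoly A) z \<noteq> 0"
proof -
  obtain \<Phi> where \<Phi>: "\<And>z. z \<in> D \<Longrightarrow> (\<Phi> has_field_derivative poly (cpoly B) z / poly (cpoly A) z) (at z)"
    "\<And>z. z \<in> D \<Longrightarrow> w z = exp (\<Phi> z)" and "open D"
    using assms(1) unfolding is_branch_def by blast
  have "((\<lambda>z. exp (\<Phi> z)) has_field_derivative exp (\<Phi> z) * (poly (cpoly B) z / poly (cpoly A) z)) (at z)"
    by (rule DERIV_fun_exp[OF \<Phi>(1)[OF assms(2)]])
  then show "(w has_field_derivative poly (cpoly B) z / poly (cpoly A) z * w z) (at z)"
    unfolding \<Phi>(2)[OF assms(2)] mult.commute[of _ "exp _"]
    by (rule has_field_derivative_transform_within_open[OF _ \<open>open D\<close> assms(2)]) (simp add: \<Phi>(2))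
  show "w z \<noteq> 0" using \<Phi>(2) assms(2) by simp
  show "poly (cpoly A) z \<noteq> 0" using assms unfolding is_branch_def by blast
qed

lemma second_kind_derivatives:
  fixes A B C T P :: "complex poly"
  assumes D: "open D" "\<And>z. z \<in> D \<Longrightarrow> poly A z \<noteq> 0" "\<And>z. z \<in> D \<Longrightarrow> w z \<noteq> 0"
    and w: "\<And>z. z \<in> D \<Longrightarrow> (w has_field_derivative poly B z / poly A z * w z) (at z)"
    and \<Psi>: "\<And>z. z \<in> D \<Longrightarrow> (\<Psi> has_field_derivative (poly B z * \<Psi> z + poly C z) / poly A z) (at z)"
    and q: "\<And>z. z \<in> D \<Longrightarrow> q z = (poly P z * \<Psi> z + poly T z) / w z"
  shows "\<And>z. z \<in> D \<Longrightarrow> (deriv ^^ k) q z = poly ((pderiv ^^ k) P) z * (\<Psi> z / w z)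
            + poly (second_kind_numerator A B C P T k) z / (poly A z ^ k * w z)" (is "\<And>z. _ \<Longrightarrow> ?P k z")
    and "q holomorphic_on D"
proof -
  let ?S = "second_kind_numerator A B C P T"
  let ?f = "\<lambda>k z. poly ((pderiv ^^ k) P) z * (\<Psi> z / w z) + poly (?S k) z / (poly A z ^ k * w z)"
  have f: "(?f k has_field_derivative ?f (Suc k) z) (at z)" if z: "z \<in> D" for k z
  proof -
    have u: "((\<lambda>z. \<Psi> z / w z) has_field_derivative poly C z / (poly A z * w z)) (at z)"
      using D(2,3)[OF z] by (auto intro!: derivative_eq_intros \<Psi> w z simp: field_simps)
    have Ak: "((\<lambda>z. poly A z ^ k) has_field_derivative of_nat k * poly (pderiv A) z * poly A z ^ k / poly A z) (at z)"
      using D(2)[OF z] by (intro DERIV_power[OF poly_DERIV, THEN DERIV_cong]) (cases k; simp add: field_simps)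
    have Aw: "((\<lambda>z. poly A z ^ k * w z) has_field_derivative
         (of_nat k * poly (pderiv A) z + poly B z) * (poly A z ^ k * w z) / poly A z) (at z)"
      using D(2)[OF z] by (intro DERIV_mult[OF Ak w[OF z], THEN DERIV_cong]) (simp add: field_simps)
    have "((\<lambda>z. poly (?S k) z / (poly A z ^ k * w z)) has_field_derivative
        (poly A z * poly (pderiv (?S k)) z - (of_nat k * poly (pderiv A) z + poly B z) * poly (?S k) z)
           / (poly A z ^ Suc k * w z)) (at z)"
      using D(2,3)[OF z] by (intro DERIV_divide[OF poly_DERIV Aw, THEN DERIV_cong]) (simp_all add: field_simps)
    note S = this
    show ?thesis
      by (rule DERIV_cong[OF DERIV_add[OF DERIV_mult[OF poly_DERIV u] S]])
         (use D(2,3)[OF z] in \<open>simp add: field_simps\<close>)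
  qed
  show k: "?P k z" if "z \<in> D" for k z
    using that
  proof (induction k arbitrary: z)
    case 0
    then show ?case using D(3)[of z] by (simp add: q field_simps)
  next
    case (Suc k)
    have "((deriv ^^ k) q has_field_derivative ?f (Suc k) z) (at z)"
      by (rule has_field_derivative_transform_within_open[OF f D(1)]) (use Suc in auto)
    then show ?case by (simp add: DERIV_imp_deriv)
  qed
  have "?f 0 holomorphic_on D"
    unfolding holomorphic_on_open[OF D(1)] using f by blast
  moreover have "?f 0 z = q z" if "z \<in> D" for z
    using k[OF that, of 0] by simp
  ultimately show "q holomorphic_on D" by (rule holomorphic_transform)
qed

text \<open>
  The last property describes the Cauchy transform \<open>Q\<close> of \<open>P\<close> at infinity, away from the real axis: the moments of order less than
  \<open>n\<close> vanish, so \<open>Q\<close> is \<open>- m_n z^(- n - 1)\<close> up to an error of the next order, where \<open>m_n\<close> is the first moment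
  that need not vanish.
\<close>

lemma second_kind_representation:
  fixes P :: "complex poly"
  assumes weight: "semiclassical_weight A B J \<rho>"
  obtains \<Psi> C T where
    "\<And>z. z \<notin> of_real ` Delta J \<Longrightarrow> (\<Psi> has_field_derivative deriv \<Psi> z) (at z)"
    "\<And>z. z \<notin> of_real ` Delta J \<Longrightarrow> poly (cpoly A) z * deriv \<Psi> z = poly (cpoly B) z * \<Psi> z + poly C z"
    "\<And>z w. z \<notin> of_real ` Delta J \<Longrightarrow> second_kind J \<rho> P w z = (poly P z * \<Psi> z + poly T z) / w z"
    "\<And>n. (\<And>j. j < n \<Longrightarrow> weighted_moment J \<rho> P j = 0) \<Longrightarrow>
       \<exists>K. \<forall>z. Im z \<noteq> 0 \<longrightarrow>
         norm (z ^ Suc n * (poly P z * \<Psi> z + poly T z) + weighted_moment J \<rho> P n) \<le> K / \<bar>Im z\<bar>"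
proof -
  interpret pearson_measure "weight_measure J \<rho>" "Delta J" "cpoly A" "cpoly B"
    by (rule weight_pearson_measure[OF weight])
  obtain C where C: "\<And>z. z \<notin> of_real ` Delta J \<Longrightarrow>
     poly (cpoly A) z * deriv (cauchy_transform 1) z = poly (cpoly B) z * cauchy_transform 1 z + poly C z"
    using stieltjes_ode by blast
  obtain T where T: "\<And>z. z \<notin> of_real ` Delta J \<Longrightarrow> cauchy_transform P z = poly P z * cauchy_transform 1 z + poly T z"
    using cauchy_transform_split by blast
  show thesis
  proof (rule that[of "cauchy_transform 1" C T])
    show "(cauchy_transform 1 has_field_derivative deriv (cauchy_transform 1) z) (at z)"
      if "z \<notin> of_real ` Delta J" for z
      using cauchy_transform_derivative[OF that, of 1] by (metis DERIV_imp_deriv)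
    show "second_kind J \<rho> P w z = (poly P z * cauchy_transform 1 z + poly T z) / w z"
      if "z \<notin> of_real ` Delta J" for z w
      by (simp add: second_kind_eq[OF weight] T[OF that])
    fix n assume mom: "\<And>j. j < n \<Longrightarrow> weighted_moment J \<rho> P j = 0"
    let ?p = "monom 1 (Suc n) * P"
    let ?K = "\<integral>t. norm (poly ?p (complex_of_real t)) \<partial>weight_measure J \<rho>"
    have "norm (z ^ Suc n * (poly P z * cauchy_transform 1 z + poly T z) + weighted_moment J \<rho> P n) \<le> ?K / \<bar>Im z\<bar>"
      if z: "Im z \<noteq> 0" for z
    proof -
      have z': "z \<notin> of_real ` Delta J" using z by auto
      have "?p = pCons 0 (monom 1 n * P)" by (simp add: monom_Suc)
      then have "cauchy_transform ?p z = z * cauchy_transform (monom 1 n * P) z + weighted_moment J \<rho> P n"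
        by (simp add: cauchy_transform_times_linear[OF z'] poly_monom weighted_moment_eq[OF weight])
      also have "cauchy_transform (monom 1 n * P) z = z ^ n * cauchy_transform P z"
        using mom by (intro cauchy_transform_monom_mult z') (simp add: weighted_moment_eq[OF weight])
      finally show ?thesis
        using cauchy_transform_bound[OF z, of ?p] by (simp add: T[OF z'] mult.assoc)
    qed
    then show "\<exists>K. \<forall>z. Im z \<noteq> 0 \<longrightarrow>
         norm (z ^ Suc n * (poly P z * cauchy_transform 1 z + poly T z) + weighted_moment J \<rho> P n) \<le> K / \<bar>Im z\<bar>"
      by blast
  qed (rule C)
qed

section \<open>Growth along the imaginary axis\<close>

text \<open>
  The exponent may be negative. The bound starts at \<open>y = 2\<close> so that the disc of radius \<open>y/2\<close> about \<open>\<i> y\<close>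
  stays in the half plane \<open>Im z \<ge> 1\<close>.
\<close>

definition axis_growth :: "(complex \<Rightarrow> complex) \<Rightarrow> int \<Rightarrow> bool" where
  "axis_growth f e \<longleftrightarrow> (\<exists>K. \<forall>y\<ge>2. norm (f (\<i> * of_real y)) \<le> K * y powi e)"

lemma axis_growth_mult:
  assumes "axis_growth f d" "axis_growth g e" "d + e = s"
  shows "axis_growth (\<lambda>z. f z * g z) s"
proof -
  obtain K L where KL: "\<And>y. y \<ge> 2 \<Longrightarrow> norm (f (\<i> * of_real y)) \<le> K * y powi d"
      "\<And>y. y \<ge> 2 \<Longrightarrow> norm (g (\<i> * of_real y)) \<le> L * y powi e"
    using assms(1,2) unfolding axis_growth_def by metis
  have "norm (f (\<i> * of_real y) * g (\<i> * of_real y)) \<le> K * L * y powi s" if y: "y \<ge> 2" for y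
  proof -
    have "norm (f (\<i> * of_real y)) * norm (g (\<i> * of_real y)) \<le> (K * y powi d) * (L * y powi e)"
      using KL[OF y] by (intro mult_mono') (auto intro: order_trans[OF norm_ge_zero])
    also have "\<dots> = K * L * y powi s"
      using y by (simp add: power_int_add flip: assms(3))
    finally show ?thesis by (simp add: norm_mult)
  qed
  then show ?thesis unfolding axis_growth_def by blast
qed

lemma axis_growth_diff:
  assumes "axis_growth f e" "axis_growth g e"
  shows "axis_growth (\<lambda>z. f z - g z) e"
proof -
  obtain K L where KL: "\<And>y. y \<ge> 2 \<Longrightarrow> norm (f (\<i> * of_real y)) \<le> K * y powi e"
      "\<And>y. y \<ge> 2 \<Longrightarrow> norm (g (\<i> * of_real y)) \<le> L * y powi e"
    using assms unfolding axis_growth_def by metis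
  have "norm (f (\<i> * of_real y) - g (\<i> * of_real y)) \<le> (K + L) * y powi e" if y: "y \<ge> 2" for y
    using KL[OF y] norm_triangle_ineq4[of "f (\<i> * of_real y)" "g (\<i> * of_real y)"]
    by (simp add: distrib_right)
  then show ?thesis unfolding axis_growth_def by blast
qed

lemma axis_growth_add:
  assumes "axis_growth f e" "axis_growth g e"
  shows "axis_growth (\<lambda>z. f z + g z) e"
proof -
  have "axis_growth (\<lambda>z. 0 - g z) e"
    by (rule axis_growth_diff[OF _ assms(2)]) (auto simp: axis_growth_def intro!: exI[of _ 0])
  from axis_growth_diff[OF assms(1) this] show ?thesis by simp
qed

lemma axis_growth_poly:
  assumes "degree_le p e"
  shows "axis_growth (poly p) e"
proof (cases "p = 0")
  case True
  then show ?thesis by (auto simp: axis_growth_def intro!: exI[of _ 0])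
next
  case False
  then have deg: "int (degree p) \<le> e" using assms by (simp add: degree_le_def)
  have "norm (poly p (\<i> * of_real y)) \<le> (\<Sum>i\<le>degree p. norm (coeff p i)) * y powi e" if y: "y \<ge> 2" for y
  proof -
    have "norm (poly p (\<i> * of_real y)) \<le> (\<Sum>i\<le>degree p. norm (coeff p i * (\<i> * of_real y) ^ i))"
      unfolding poly_altdef by (rule norm_sum)
    also have "\<dots> \<le> (\<Sum>i\<le>degree p. norm (coeff p i) * y powi e)"
    proof (rule sum_mono)
      fix i assume i: "i \<in> {..degree p}"
      have "norm ((\<i> * complex_of_real y) ^ i) = y powi (int i)"
        using y by (simp add: norm_power norm_mult)
      also have "\<dots> \<le> y powi e" using i deg y by (intro power_int_increasing) auto
      finally show "norm (coeff p i * (\<i> * of_real y) ^ i) \<le> norm (coeff p i) * y powi e"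
        unfolding norm_mult by (intro mult_left_mono) auto
    qed
    finally show ?thesis by (simp add: sum_distrib_right)
  qed
  then show ?thesis unfolding axis_growth_def by blast
qed

text \<open>
  Cauchy's inequality on the disc of radius \<open>y/2\<close> about \<open>\<i> y\<close> gains one power of \<open>y\<close> per derivative.
\<close>

lemma axis_growth_deriv:
  assumes hol: "f holomorphic_on {z. Im z > 0}"
    and bound: "\<And>z. Im z \<ge> 1 \<Longrightarrow> norm (f z) \<le> K / Im z ^ m"
  shows "axis_growth ((deriv ^^ k) f) (- int (m + k))"
proof -
  have "norm ((deriv ^^ k) f (\<i> * of_real y)) \<le> fact k * K * 2 ^ (m + k) * y powi (- int (m + k))"
    if y: "y \<ge> 2" for y
  proof -
    have Im: "Im z \<ge> y / 2" if "norm (\<i> * of_real y - z) \<le> y / 2" for z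
      using abs_Im_le_cmod[of "\<i> * of_real y - z"] that by simp
    have K: "K \<ge> 0" using order_trans[OF norm_ge_zero bound[of \<i>]] by simp
    have sub: "cball (\<i> * of_real y) (y / 2) \<subseteq> {z. Im z > 0}"
      using Im y by (force simp: dist_norm)
    have "norm ((deriv ^^ k) f (\<i> * of_real y)) \<le> fact k * (K / (y / 2) ^ m) / (y / 2) ^ k"
    proof (rule Cauchy_inequality)
      show "f holomorphic_on ball (\<i> * of_real y) (y / 2)"
        using sub ball_subset_cball by (blast intro: holomorphic_on_subset[OF hol])
      show "continuous_on (cball (\<i> * of_real y) (y / 2)) f"
        using sub by (blast intro: continuous_on_subset[OF holomorphic_on_imp_continuous_on[OF hol]])
      fix z assume "norm (\<i> * of_real y - z) = y / 2"
      then have "Im z \<ge> y / 2" using Im by simp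
      then have "norm (f z) \<le> K / Im z ^ m" using y by (intro bound) auto
      also have "\<dots> \<le> K / (y / 2) ^ m"
        using K y \<open>Im z \<ge> y / 2\<close> by (intro divide_left_mono power_mono mult_pos_pos) auto
      finally show "norm (f z) \<le> K / (y / 2) ^ m" .
    qed (use y in simp)
    also have "\<dots> = fact k * K * 2 ^ (m + k) * y powi (- int (m + k))"
      using y by (simp add: power_int_minus power_add power_divide divide_simps del: of_nat_add)
    finally show ?thesis .
  qed
  then show ?thesis unfolding axis_growth_def by blast
qed

lemma axis_growth_0_imp_degree_0:
  assumes "axis_growth (poly p) 0" shows "degree p = 0"
proof (rule ccontr)
  obtain K where K: "\<And>y. y \<ge> 2 \<Longrightarrow> norm (poly p (\<i> * of_real y)) \<le> K"
    using assms by (auto simp: axis_growth_def)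
  assume "degree p \<noteq> 0"
  then have "filterlim (poly p) at_infinity at_infinity" by (intro filterlim_poly_at_infinity) simp
  moreover have "filterlim (\<lambda>y. \<i> * complex_of_real y) at_infinity at_top"
    by (rule filterlim_norm_at_top_imp_at_infinity) (simp add: norm_mult filterlim_abs_real)
  ultimately have "filterlim (\<lambda>y. poly p (\<i> * complex_of_real y)) at_infinity at_top"
    by (rule filterlim_compose)
  then have "\<forall>\<^sub>F y in at_top. norm (poly p (\<i> * complex_of_real y)) \<ge> \<bar>K\<bar> + 1"
    by (subst (asm) filterlim_at_infinity[of 0]) auto
  then have "\<forall>\<^sub>F y::real in at_top. False"
    using eventually_ge_at_top[of 2] by eventually_elim (use K in force)
  then show False by simp
qed

text \<open>
  \<open>R/A\<^sup>2\<close> equals \<open>(A\<^sup>2/w) Wrons(P w, Q1, Q2)\<close>, where \<open>Q = q w\<close> are the Cauchy transforms. Writing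
  \<open>S_1\<close> and \<open>P' C + S_1'\<close> in terms of \<open>Q\<close>, \<open>Q'\<close>, \<open>Q''\<close> and \<open>\<Psi>\<close> shows this also at zeros of \<open>A\<close>; the
  contributions of \<open>\<Psi>\<close> cancel in the determinant.
\<close>

lemma equal_weight_core_eval:
  fixes A B P C1 T1 C2 T2 :: "complex poly" and \<Psi>1 \<Psi>2 :: "complex \<Rightarrow> complex"
  defines "Q1 \<equiv> \<lambda>z. poly P z * \<Psi>1 z + poly T1 z" and "Q2 \<equiv> \<lambda>z. poly P z * \<Psi>2 z + poly T2 z"
  assumes D: "open D" "z \<in> D"
    and \<Psi>1: "\<And>z. z \<in> D \<Longrightarrow> (\<Psi>1 has_field_derivative deriv \<Psi>1 z) (at z)"
      "\<And>z. z \<in> D \<Longrightarrow> poly A z * deriv \<Psi>1 z = poly B z * \<Psi>1 z + poly C1 z"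
    and \<Psi>2: "\<And>z. z \<in> D \<Longrightarrow> (\<Psi>2 has_field_derivative deriv \<Psi>2 z) (at z)"
      "\<And>z. z \<in> D \<Longrightarrow> poly A z * deriv \<Psi>2 z = poly B z * \<Psi>2 z + poly C2 z"
  shows "poly (ode_polynomials.equal_weight_core A B C1 T1 C2 T2 P) z =
     poly (A\<^sup>2 * P) z * (deriv Q1 z * (deriv ^^ 2) Q2 z - (deriv ^^ 2) Q1 z * deriv Q2 z)
     - poly (A * (A * pderiv P + B * P)) z * (Q1 z * (deriv ^^ 2) Q2 z - (deriv ^^ 2) Q1 z * Q2 z)
     + poly (A\<^sup>2 * pderiv (pderiv P) + 2 * A * B * pderiv P + (A * pderiv B - pderiv A * B + B\<^sup>2) * P) z
         * (Q1 z * deriv Q2 z - deriv Q1 z * Q2 z)"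
proof -
  have key: "poly (second_kind_numerator A B C P T 1) z =
        poly A z * deriv Q z - poly B z * Q z - poly A z * poly (pderiv P) z * \<Psi> z \<and>
      poly (pderiv P * C + pderiv (second_kind_numerator A B C P T 1)) z =
        poly A z * (deriv ^^ 2) Q z - (poly B z - poly (pderiv A) z) * deriv Q z - poly (pderiv B) z * Q z
        - (poly (pderiv A) z * poly (pderiv P) z + poly A z * poly (pderiv (pderiv P)) z
            + poly B z * poly (pderiv P) z) * \<Psi> z"
    if \<Psi>: "\<And>z. z \<in> D \<Longrightarrow> (\<Psi> has_field_derivative deriv \<Psi> z) (at z)"
      "\<And>z. z \<in> D \<Longrightarrow> poly A z * deriv \<Psi> z = poly B z * \<Psi> z + poly C z"
      and Q: "Q = (\<lambda>z. poly P z * \<Psi> z + poly T z)" for C T \<Psi> Q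
  proof -
    let ?S = "second_kind_numerator A B C P T 1"
    have hol: "\<Psi> holomorphic_on D" using \<Psi>(1) D(1) by (auto simp: holomorphic_on_open)
    have holQ: "Q holomorphic_on D" unfolding Q by (intro holomorphic_intros hol)
    have dQ: "deriv Q z = poly P z * deriv \<Psi> z + poly (pderiv P) z * \<Psi> z + poly (pderiv T) z" if "z \<in> D" for z
      unfolding Q by (rule DERIV_imp_deriv) (auto intro!: derivative_eq_intros \<Psi>(1) that poly_DERIV)
    have S: "poly ?S z = poly A z * deriv Q z - poly B z * Q z - poly A z * poly (pderiv P) z * \<Psi> z" if "z \<in> D" for z
    proof -
      have "poly A z * deriv Q z = poly P z * (poly A z * deriv \<Psi> z) + poly A z * poly (pderiv P) z * \<Psi> z
              + poly A z * poly (pderiv T) z"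
        unfolding dQ[OF that] by (simp add: algebra_simps)
      then show ?thesis unfolding \<Psi>(2)[OF that] by (simp add: Q algebra_simps)
    qed
    have d1: "(Q has_field_derivative deriv Q z) (at z)" "(deriv Q has_field_derivative (deriv ^^ 2) Q z) (at z)"
      using holomorphic_derivI[OF holQ D] holomorphic_derivI[OF holomorphic_deriv[OF holQ D(1)] D]
      by (simp_all add: numeral_2_eq_2)
    have "((\<lambda>z. poly A z * deriv Q z - poly B z * Q z - poly A z * poly (pderiv P) z * \<Psi> z) has_field_derivative
       (poly (pderiv A) z * deriv Q z + (deriv ^^ 2) Q z * poly A z) - (poly (pderiv B) z * Q z + deriv Q z * poly B z)
         - ((poly (pderiv A) z * poly (pderiv P) z + poly (pderiv (pderiv P)) z * poly A z) * \<Psi> z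
             + deriv \<Psi> z * (poly A z * poly (pderiv P) z))) (at z)"
      by (intro DERIV_diff DERIV_mult poly_DERIV d1 \<Psi>(1) D(2))
    then have "(poly ?S has_field_derivative
       (poly (pderiv A) z * deriv Q z + (deriv ^^ 2) Q z * poly A z) - (poly (pderiv B) z * Q z + deriv Q z * poly B z)
         - ((poly (pderiv A) z * poly (pderiv P) z + poly (pderiv (pderiv P)) z * poly A z) * \<Psi> z
             + deriv \<Psi> z * (poly A z * poly (pderiv P) z))) (at z)"
      by (rule has_field_derivative_transform_within_open[OF _ D]) (rule S[symmetric])
    from DERIV_unique[OF poly_DERIV this]
    have "poly (pderiv ?S) z = (poly (pderiv A) z * deriv Q z + (deriv ^^ 2) Q z * poly A z)
         - (poly (pderiv B) z * Q z + deriv Q z * poly B z)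
         - ((poly (pderiv A) z * poly (pderiv P) z + poly (pderiv (pderiv P)) z * poly A z) * \<Psi> z
             + poly (pderiv P) z * (poly A z * deriv \<Psi> z))"
      by (simp only: mult_ac)
    then have "poly (pderiv P * C + pderiv ?S) z =
        poly A z * (deriv ^^ 2) Q z - (poly B z - poly (pderiv A) z) * deriv Q z - poly (pderiv B) z * Q z
        - (poly (pderiv A) z * poly (pderiv P) z + poly A z * poly (pderiv (pderiv P)) z
            + poly B z * poly (pderiv P) z) * \<Psi> z"
      unfolding \<Psi>(2)[OF D(2)] by (simp add: algebra_simps del: second_kind_numerator.simps One_nat_def)
    with S[OF D(2)] show ?thesis by blast
  qed
  define S1 where "S1 = second_kind_numerator A B C1 P T1"
  define S2 where "S2 = second_kind_numerator A B C2 P T2"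
  define X1 where "X1 = pderiv P * C1 + pderiv (S1 1)"
  define X2 where "X2 = pderiv P * C2 + pderiv (S2 1)"
  have k1: "poly (S1 1) z = poly A z * deriv Q1 z - poly B z * Q1 z - poly A z * poly (pderiv P) z * \<Psi>1 z"
     "poly X1 z = poly A z * (deriv ^^ 2) Q1 z - (poly B z - poly (pderiv A) z) * deriv Q1 z - poly (pderiv B) z * Q1 z
        - (poly (pderiv A) z * poly (pderiv P) z + poly A z * poly (pderiv (pderiv P)) z
            + poly B z * poly (pderiv P) z) * \<Psi>1 z"
    using key[OF \<Psi>1 Q1_def[THEN meta_eq_to_obj_eq]] unfolding X1_def S1_def by blast+
  have k2: "poly (S2 1) z = poly A z * deriv Q2 z - poly B z * Q2 z - poly A z * poly (pderiv P) z * \<Psi>2 z"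
     "poly X2 z = poly A z * (deriv ^^ 2) Q2 z - (poly B z - poly (pderiv A) z) * deriv Q2 z - poly (pderiv B) z * Q2 z
        - (poly (pderiv A) z * poly (pderiv P) z + poly A z * poly (pderiv (pderiv P)) z
            + poly B z * poly (pderiv P) z) * \<Psi>2 z"
    using key[OF \<Psi>2 Q2_def[THEN meta_eq_to_obj_eq]] unfolding X2_def S2_def by blast+
  have T: "poly T1 z = Q1 z - poly P z * \<Psi>1 z" "poly T2 z = Q2 z - poly P z * \<Psi>2 z"
    by (simp_all add: Q1_def Q2_def)
  have 2: "S1 2 = A * X1 - (pderiv A + B) * S1 1" "S2 2 = A * X2 - (pderiv A + B) * S2 1"
    by (simp_all add: S1_def S2_def X1_def X2_def numeral_2_eq_2 algebra_simps)
  show ?thesis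
    unfolding ode_polynomials.equal_weight_core_def Let_def S1_def[symmetric] S2_def[symmetric]
      X1_def[symmetric] X2_def[symmetric] 2 poly_add poly_diff poly_mult poly_power k1 k2 T
    by (simp add: algebra_simps power2_eq_square)
qed

lemma axis_growth_cong:
  assumes "axis_growth f e" "\<And>z. Im z > 0 \<Longrightarrow> f z = g z"
  shows "axis_growth g e"
  using assms by (simp add: axis_growth_def)

text \<open>
  The Cauchy transforms \<open>Q1\<close> and \<open>Q2\<close> both decay at least like \<open>z^(- n - 1)\<close>. As \<open>m1 \<noteq> 0\<close>, the leading term of
  \<open>Q2\<close> can be cancelled by subtracting a multiple of \<open>Q1\<close>, which leaves the determinant unchanged and
  gains one order. The three coefficients \<open>(A\<^sup>2/w) (P w)^(k)\<close> have degrees at most \<open>2 n + 6 - k\<close>, and they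
  exactly compensate the decay of the minors that they multiply.
\<close>

lemma equal_weight_core_constant:
  fixes A B P C1 T1 C2 T2 :: "complex poly" and \<Psi>1 \<Psi>2 :: "complex \<Rightarrow> complex"
  defines "Q1 \<equiv> \<lambda>z. poly P z * \<Psi>1 z + poly T1 z" and "Q2 \<equiv> \<lambda>z. poly P z * \<Psi>2 z + poly T2 z"
  assumes \<Psi>1: "\<And>z. Im z > 0 \<Longrightarrow> (\<Psi>1 has_field_derivative deriv \<Psi>1 z) (at z)"
      "\<And>z. Im z > 0 \<Longrightarrow> poly A z * deriv \<Psi>1 z = poly B z * \<Psi>1 z + poly C1 z"
    and \<Psi>2: "\<And>z. Im z > 0 \<Longrightarrow> (\<Psi>2 has_field_derivative deriv \<Psi>2 z) (at z)"
      "\<And>z. Im z > 0 \<Longrightarrow> poly A z * deriv \<Psi>2 z = poly B z * \<Psi>2 z + poly C2 z"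
    and K1: "\<And>z. Im z > 0 \<Longrightarrow> norm (z ^ Suc n * Q1 z + m1) \<le> K1 / Im z"
    and K2: "\<And>z. Im z > 0 \<Longrightarrow> norm (z ^ Suc n * Q2 z + m2) \<le> K2 / Im z"
    and m1: "m1 \<noteq> 0"
    and deg: "degree_le A 3" "degree_le B 2" "degree_le P (2 * int n)"
  shows "degree (ode_polynomials.equal_weight_core A B C1 T1 C2 T2 P) = 0"
proof -
  define H where "H = {z::complex. Im z > 0}"
  have H: "open H" unfolding H_def by (rule open_halfspace_Im_gt)
  define \<mu> where "\<mu> = m2 / m1"
  define U where "U z = Q2 z - \<mu> * Q1 z" for z
  have hol\<Psi>: "\<Psi>1 holomorphic_on H" "\<Psi>2 holomorphic_on H"
    using \<Psi>1(1) \<Psi>2(1) H by (auto simp: holomorphic_on_open H_def)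
  have hol: "Q1 holomorphic_on H" "Q2 holomorphic_on H" "U holomorphic_on H"
    unfolding U_def Q1_def Q2_def by (intro holomorphic_intros hol\<Psi>)+
  have pos: "K1 \<ge> 0" "K2 \<ge> 0"
    using order_trans[OF norm_ge_zero K1[of \<i>]] order_trans[OF norm_ge_zero K2[of \<i>]] by simp_all
  have decay: "norm w \<le> K / Im z ^ Suc n" if "norm (z ^ Suc n * w) \<le> K" "Im z \<ge> 1" for z w :: complex and K
  proof -
    have z: "0 < norm z" "Im z \<le> norm z" using that(2) abs_Im_le_cmod[of z] by auto
    have K: "0 \<le> K" using order_trans[OF norm_ge_zero that(1)] .
    have "norm w \<le> K / norm z ^ Suc n"
      using that(1) z(1) by (simp add: norm_mult norm_power pos_le_divide_eq mult_ac)
    also have "\<dots> \<le> K / Im z ^ Suc n"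
      using K z that(2) by (intro divide_left_mono power_mono mult_pos_pos zero_less_power) auto
    finally show ?thesis .
  qed
  have bQ1: "norm (Q1 z) \<le> (K1 + norm m1) / Im z ^ Suc n" if z: "Im z \<ge> 1" for z
  proof (rule decay[OF _ z])
    have "norm (z ^ Suc n * Q1 z) \<le> norm (z ^ Suc n * Q1 z + m1) + norm m1"
      using norm_triangle_ineq4[of "z ^ Suc n * Q1 z + m1" m1] by simp
    also have "\<dots> \<le> K1 / Im z + norm m1" using K1[of z] z by simp
    also have "\<dots> \<le> K1 + norm m1"
      using pos z by (simp add: divide_le_eq mult_left_mono[of 1 "Im z" K1, simplified])
    finally show "norm (z ^ Suc n * Q1 z) \<le> K1 + norm m1" .
  qed
  have bU: "norm (U z) \<le> (K2 + norm \<mu> * K1) / Im z ^ Suc (Suc n)" if z: "Im z \<ge> 1" for z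
  proof -
    have "z ^ Suc n * U z = (z ^ Suc n * Q2 z + m2) - \<mu> * (z ^ Suc n * Q1 z + m1)"
      using m1 by (simp add: U_def \<mu>_def algebra_simps)
    then have "norm (z ^ Suc n * U z) \<le> norm (z ^ Suc n * Q2 z + m2) + norm (\<mu> * (z ^ Suc n * Q1 z + m1))"
      using norm_triangle_ineq4 by metis
    also have "\<dots> \<le> K2 / Im z + norm \<mu> * (K1 / Im z)"
      unfolding norm_mult[of \<mu>] using K1[of z] K2[of z] z by (intro add_mono mult_left_mono) auto
    finally have "norm (z ^ Suc n * U z) \<le> (K2 + norm \<mu> * K1) / Im z"
      by (simp add: add_divide_distrib)
    from decay[OF this z] show ?thesis by (simp add: mult_ac)
  qed
  have g1: "axis_growth ((deriv ^^ k) Q1) (- int (Suc n + k))" for k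
    by (rule axis_growth_deriv[OF hol(1)[unfolded H_def] bQ1])
  have gU: "axis_growth ((deriv ^^ k) U) (- int (Suc (Suc n) + k))" for k
    by (rule axis_growth_deriv[OF hol(3)[unfolded H_def] bU])
  have dQ2: "(deriv ^^ k) Q2 z = (deriv ^^ k) U z + \<mu> * (deriv ^^ k) Q1 z" if "Im z > 0" for k z
  proof -
    have z: "z \<in> H" using that by (simp add: H_def)
    have "(deriv ^^ k) U z = (deriv ^^ k) Q2 z - (deriv ^^ k) (\<lambda>z. \<mu> * Q1 z) z"
      unfolding U_def[abs_def] by (intro higher_deriv_diff[OF hol(2) _ H z] holomorphic_intros hol)
    then show ?thesis by (simp add: higher_deriv_cmult[OF hol(1) z H])
  qed
  let ?p0 = "A\<^sup>2 * P" and ?p1 = "A * (A * pderiv P + B * P)"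
    and ?p2 = "A\<^sup>2 * pderiv (pderiv P) + 2 * A * B * pderiv P + (A * pderiv B - pderiv A * B + B\<^sup>2) * P"
  have core: "poly (ode_polynomials.equal_weight_core A B C1 T1 C2 T2 P) z =
       poly ?p0 z * ((deriv ^^ 1) Q1 z * (deriv ^^ 2) U z - (deriv ^^ 2) Q1 z * (deriv ^^ 1) U z)
     - poly ?p1 z * ((deriv ^^ 0) Q1 z * (deriv ^^ 2) U z - (deriv ^^ 2) Q1 z * (deriv ^^ 0) U z)
     + poly ?p2 z * ((deriv ^^ 0) Q1 z * (deriv ^^ 1) U z - (deriv ^^ 1) Q1 z * (deriv ^^ 0) U z)"
    if z: "Im z > 0" for z
  proof -
    have zH: "z \<in> H" using z by (simp add: H_def)
    have "poly (ode_polynomials.equal_weight_core A B C1 T1 C2 T2 P) z =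
       poly ?p0 z * (deriv Q1 z * (deriv ^^ 2) Q2 z - (deriv ^^ 2) Q1 z * deriv Q2 z)
     - poly ?p1 z * (Q1 z * (deriv ^^ 2) Q2 z - (deriv ^^ 2) Q1 z * Q2 z)
     + poly ?p2 z * (Q1 z * deriv Q2 z - deriv Q1 z * Q2 z)"
      unfolding Q1_def Q2_def
      by (rule equal_weight_core_eval[OF H zH]) (use \<Psi>1 \<Psi>2 in \<open>auto simp: H_def\<close>)
    then show ?thesis
      using dQ2[OF z, of 0] dQ2[OF z, of 1] dQ2[OF z, of 2] by (simp add: algebra_simps del: poly_mult poly_add poly_diff)
  qed
  note ds = deg degree_le_mult degree_le_pderiv
  have p0: "degree_le ?p0 (2 * int n + 6)"
    unfolding power2_eq_square by (rule degree_le_mono, (rule ds)+) simp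
  have p1: "degree_le ?p1 (2 * int n + 5)"
    unfolding distrib_left by (intro degree_le_add; rule degree_le_mono, (rule ds)+) simp_all
  have p2: "degree_le ?p2 (2 * int n + 4)"
    unfolding power2_eq_square mult_2 distrib_left distrib_right left_diff_distrib
    by (intro degree_le_add degree_le_diff; rule degree_le_mono, (rule ds)+) simp_all
  have "axis_growth (poly (ode_polynomials.equal_weight_core A B C1 T1 C2 T2 P)) 0"
  proof (rule axis_growth_cong)
    show "axis_growth (\<lambda>z. poly ?p0 z * ((deriv ^^ 1) Q1 z * (deriv ^^ 2) U z - (deriv ^^ 2) Q1 z * (deriv ^^ 1) U z)
     - poly ?p1 z * ((deriv ^^ 0) Q1 z * (deriv ^^ 2) U z - (deriv ^^ 2) Q1 z * (deriv ^^ 0) U z)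
     + poly ?p2 z * ((deriv ^^ 0) Q1 z * (deriv ^^ 1) U z - (deriv ^^ 1) Q1 z * (deriv ^^ 0) U z)) 0"
    proof (intro axis_growth_add axis_growth_diff)
      show "axis_growth (\<lambda>z. poly ?p0 z * ((deriv ^^ 1) Q1 z * (deriv ^^ 2) U z - (deriv ^^ 2) Q1 z * (deriv ^^ 1) U z)) 0"
        by (rule axis_growth_mult[OF axis_growth_poly[OF p0] axis_growth_diff[where e = "- 2 * int n - 6"]];
            (rule axis_growth_mult[OF g1 gU])?) simp_all
      show "axis_growth (\<lambda>z. poly ?p1 z * ((deriv ^^ 0) Q1 z * (deriv ^^ 2) U z - (deriv ^^ 2) Q1 z * (deriv ^^ 0) U z)) 0"
        by (rule axis_growth_mult[OF axis_growth_poly[OF p1] axis_growth_diff[where e = "- 2 * int n - 5"]];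
            (rule axis_growth_mult[OF g1 gU])?) simp_all
      show "axis_growth (\<lambda>z. poly ?p2 z * ((deriv ^^ 0) Q1 z * (deriv ^^ 1) U z - (deriv ^^ 1) Q1 z * (deriv ^^ 0) U z)) 0"
        by (rule axis_growth_mult[OF axis_growth_poly[OF p2] axis_growth_diff[where e = "- 2 * int n - 4"]];
            (rule axis_growth_mult[OF g1 gU])?) simp_all
    qed
  qed (simp add: core del: poly_mult poly_add poly_diff)
  then show ?thesis by (rule axis_growth_0_imp_degree_0)
qed

section \<open>The third-order equation\<close>

lemma higher_deriv_poly: "(deriv ^^ k) (poly p) = poly ((pderiv ^^ k) p)" for p :: "complex poly"
proof (induction k)
  case (Suc k)
  have "deriv (poly q) = poly (pderiv q)" for q :: "complex poly"
    by (rule ext) (rule DERIV_imp_deriv[OF poly_DERIV])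
  with Suc show ?case by simp
qed simp

lemma degree_cpoly [simp]: "degree (cpoly A) = degree A"
  by (rule degree_map_poly) simp

lemma cpoly_eq_0_iff [simp]: "cpoly A = 0 \<longleftrightarrow> A = 0"
  by (simp add: poly_eq_iff coeff_map_poly)

lemma solves_ode3_poly:
  fixes P :: "complex poly"
  assumes "c3 * (pderiv ^^ 3) P + c2 * (pderiv ^^ 2) P + c1 * pderiv P + c0 * P = 0"
  shows "solves_ode3 c3 c2 c1 c0 D (poly P)"
proof -
  have "poly c3 z * (deriv ^^ 3) (poly P) z + poly c2 z * (deriv ^^ 2) (poly P) z
      + poly c1 z * deriv (poly P) z + poly c0 z * poly P z = 0" for z
    using arg_cong[OF assms, of "\<lambda>p. poly p z"] higher_deriv_poly[of 1 P]
    by (simp add: higher_deriv_poly)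
  then show ?thesis by (simp add: solves_ode3_def holomorphic_intros)
qed

text \<open>
  What the algebraic part needs to know about the branch \<open>q\<close> on \<open>D\<close>, with \<open>u = \<Psi>/w\<close>.
\<close>

definition second_kind_data ::
  "complex poly \<Rightarrow> complex poly \<Rightarrow> complex poly \<Rightarrow> complex poly \<Rightarrow> complex poly \<Rightarrow> (complex \<Rightarrow> complex) \<Rightarrow>
    complex set \<Rightarrow> (complex \<Rightarrow> complex) \<Rightarrow> (complex \<Rightarrow> complex) \<Rightarrow> bool" where
  "second_kind_data A B C T P \<Psi> D w q \<longleftrightarrow> q holomorphic_on D \<and>
     (\<forall>z\<in>D. poly A z \<noteq> 0 \<and> w z \<noteq> 0 \<and>
       (\<forall>k. (deriv ^^ k) q z = poly ((pderiv ^^ k) P) z * (\<Psi> z / w z)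
            + poly (second_kind_numerator A B C P T k) z / (poly A z ^ k * w z)))"

lemma scaled_numerator_eval:
  assumes "second_kind_data A B C T P \<Psi> D w q" "z \<in> D" "k \<le> m"
  shows "poly A z ^ m * w z * ((deriv ^^ k) q z - poly ((pderiv ^^ k) P) z * (\<Psi> z / w z))
     = poly (scaled_numerator A B C P T m k) z"
proof -
  have nz: "poly A z \<noteq> 0" "w z \<noteq> 0" using assms by (auto simp: second_kind_data_def)
  have "poly A z ^ m = poly A z ^ (m - k) * poly A z ^ k" using assms(3) by (simp flip: power_add)
  moreover have "(deriv ^^ k) q z - poly ((pderiv ^^ k) P) z * (\<Psi> z / w z)
      = poly (second_kind_numerator A B C P T k) z / (poly A z ^ k * w z)"
    using assms(1,2) by (simp add: second_kind_data_def)
  ultimately show ?thesis using nz by (simp add: scaled_numerator_def)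
qed

text \<open>
  The operator is applied separately to the two summands of \<open>q^(k) = P^(k) u + S_k/(A^k w)\<close>. The domain
  may meet the support of the other weight, so that the equation for \<open>q\<close> has to follow from polynomial
  identities and not from an identity of Wronskians.
\<close>

lemma solves_ode3_second_kind:
  assumes data: "second_kind_data A B C T P \<Psi> D w q"
    and P: "c3 * (pderiv ^^ 3) P + c2 * (pderiv ^^ 2) P + c1 * pderiv P + c0 * P = 0"
    and S: "c3 * scaled_numerator A B C P T 3 3 + c2 * scaled_numerator A B C P T 3 2
         + c1 * scaled_numerator A B C P T 3 1 + c0 * scaled_numerator A B C P T 3 0 = 0"
  shows "solves_ode3 c3 c2 c1 c0 D q"
  unfolding solves_ode3_def
proof (intro conjI ballI)
  show "q holomorphic_on D" using data by (simp add: second_kind_data_def)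
  fix z assume z: "z \<in> D"
  have nz: "poly A z \<noteq> 0" "w z \<noteq> 0" using data z by (auto simp: second_kind_data_def)
  let ?u = "\<Psi> z / w z" and ?d = "poly A z ^ 3 * w z"
  let ?r = "\<lambda>k. (deriv ^^ k) q z - poly ((pderiv ^^ k) P) z * ?u"
  note ev = scaled_numerator_eval[OF data z, of _ 3]
  have "?d * (poly c3 z * ?r 3 + poly c2 z * ?r 2 + poly c1 z * ?r 1 + poly c0 z * ?r 0) =
     poly c3 z * (?d * ?r 3) + poly c2 z * (?d * ?r 2) + poly c1 z * (?d * ?r 1) + poly c0 z * (?d * ?r 0)"
    by (simp only: distrib_left mult_ac)
  also have "\<dots> = 0"
    using arg_cong[OF S, of "\<lambda>p. poly p z"] ev[of 3] ev[of 2] ev[of 1] ev[of 0] by simp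
  finally have r: "poly c3 z * ?r 3 + poly c2 z * ?r 2 + poly c1 z * ?r 1 + poly c0 z * ?r 0 = 0"
    using nz by simp
  have p: "poly c3 z * poly ((pderiv ^^ 3) P) z + poly c2 z * poly ((pderiv ^^ 2) P) z
      + poly c1 z * poly (pderiv P) z + poly c0 z * poly P z = 0"
    using arg_cong[OF P, of "\<lambda>p. poly p z"] by simp
  have "poly c3 z * (deriv ^^ 3) q z + poly c2 z * (deriv ^^ 2) q z + poly c1 z * deriv q z + poly c0 z * q z
     = (poly c3 z * ?r 3 + poly c2 z * ?r 2 + poly c1 z * ?r 1 + poly c0 z * ?r 0)
       + (poly c3 z * poly ((pderiv ^^ 3) P) z + poly c2 z * poly ((pderiv ^^ 2) P) z
      + poly c1 z * poly (pderiv P) z + poly c0 z * poly P z) * ?u"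
    by (simp add: algebra_simps)
  then show "poly c3 z * (deriv ^^ 3) q z + poly c2 z * (deriv ^^ 2) q z + poly c1 z * deriv q z + poly c0 z * q z = 0"
    unfolding r p by simp
qed

lemma row_det_scale:
  "row_det a (\<lambda>n. s * b n) (\<lambda>n. t * c n) i j k = s * t * row_det a b c i j k"
  by (simp add: row_det_def algebra_simps)

lemma ode_polynomials_D_eval:
  assumes 1: "second_kind_data A1 B1 C1 T1 P \<Psi>1 D w1 q1" and 2: "second_kind_data A2 B2 C2 T2 P \<Psi>2 D w2 q2"
    and z: "z \<in> D" and ijk: "i \<le> m" "j \<le> m" "k \<le> m"
  shows "poly (ode_polynomials.D A1 B1 C1 T1 A2 B2 C2 T2 P m i j k) z =
     (poly A1 z ^ m * w1 z) * (poly A2 z ^ m * w2 z) * deriv_det i j k (poly P) q1 q2 z"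
proof -
  let ?P = "\<lambda>n. poly ((pderiv ^^ n) P) z"
  let ?r1 = "\<lambda>n. (deriv ^^ n) q1 z - ?P n * (\<Psi>1 z / w1 z)"
  let ?r2 = "\<lambda>n. (deriv ^^ n) q2 z - ?P n * (\<Psi>2 z / w2 z)"
  note ev = scaled_numerator_eval[OF 1 z, of _ m] scaled_numerator_eval[OF 2 z, of _ m]
  have "deriv_det i j k (poly P) q1 q2 z = row_det ?P
      (\<lambda>n. ?P n * (\<Psi>1 z / w1 z) + ?r1 n) (\<lambda>n. ?P n * (\<Psi>2 z / w2 z) + ?r2 n) i j k"
    unfolding deriv_det_eq_row_det by (simp add: higher_deriv_poly)
  also have "\<dots> = row_det ?P ?r1 ?r2 i j k" by (rule row_det_column_operation)
  finally have "(poly A1 z ^ m * w1 z) * (poly A2 z ^ m * w2 z) * deriv_det i j k (poly P) q1 q2 z =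
     row_det ?P (\<lambda>n. poly A1 z ^ m * w1 z * ?r1 n) (\<lambda>n. poly A2 z ^ m * w2 z * ?r2 n) i j k"
    by (simp only: row_det_scale)
  also have "\<dots> = poly (ode_polynomials.D A1 B1 C1 T1 A2 B2 C2 T2 P m i j k) z"
    unfolding ode_polynomials.D_def row_det_def by (simp only: ev ijk poly_add poly_diff poly_mult)
  finally show ?thesis by simp
qed


text \<open>
  Every branch on every domain gives the same polynomials \<open>C\<close> and \<open>T\<close>.
\<close>

lemma branch_second_kind_data:
  fixes P :: "complex poly"
  assumes br: "branch_off_support A B J D w"
    and \<Psi>: "\<And>z. z \<notin> of_real ` Delta J \<Longrightarrow> (\<Psi> has_field_derivative deriv \<Psi> z) (at z)"
      "\<And>z. z \<notin> of_real ` Delta J \<Longrightarrow> poly (cpoly A) z * deriv \<Psi> z = poly (cpoly B) z * \<Psi> z + poly C z"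
    and q: "\<And>z w. z \<notin> of_real ` Delta J \<Longrightarrow> second_kind J \<rho> P w z = (poly P z * \<Psi> z + poly T z) / w z"
  shows "second_kind_data (cpoly A) (cpoly B) C T P \<Psi> D w (second_kind J \<rho> P w)"
proof -
  have b: "is_branch A B D w" and off: "\<And>z. z \<in> D \<Longrightarrow> z \<notin> of_real ` Delta J"
    using br by (auto simp: branch_off_support_def)
  have D: "open D" using b by (simp add: is_branch_def)
  have d: "(\<Psi> has_field_derivative (poly (cpoly B) z * \<Psi> z + poly C z) / poly (cpoly A) z) (at z)" if z: "z \<in> D" for z
  proof -
    have "deriv \<Psi> z = (poly (cpoly B) z * \<Psi> z + poly C z) / poly (cpoly A) z"
      using \<Psi>(2)[OF off[OF z]] is_branch_derivative(3)[OF b z] by (simp add: field_simps)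
    then show ?thesis using \<Psi>(1)[OF off[OF z]] by simp
  qed
  note * = second_kind_derivatives[where q = "second_kind J \<rho> P w" and P = P and T = T, OF D is_branch_derivative(3)[OF b] is_branch_derivative(2)[OF b]
      is_branch_derivative(1)[OF b] d q[OF off]]
  show ?thesis
    unfolding second_kind_data_def
    using * is_branch_derivative(2,3)[OF b] by blast
qed

theorem theorem7p1:
  fixes A1 A2 B1 B2 :: "real poly"
    and J1 J2 :: "(ereal \<times> ereal) set"
    and \<rho>1 \<rho>2 :: "real \<Rightarrow> real"
    and n1 n2 :: nat
    and P :: "complex poly"
  assumes weight1: "semiclassical_weight A1 B1 J1 \<rho>1"
    and weight2: "semiclassical_weight A2 B2 J2 \<rho>2"
    and sigma1: "weight_class A1 B1 \<ge> 0"
    and sigma2: "weight_class A2 B2 \<ge> 0"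
    and P_monic: "lead_coeff P = 1"
    and P_degree: "degree P = n1 + n2"
    and orth1: "\<And>j. j < n1 \<Longrightarrow> weighted_moment J1 \<rho>1 P j = 0"
    and norm1: "weighted_moment J1 \<rho>1 P n1 \<noteq> 0"
    and orth2: "\<And>j. j < n2 \<Longrightarrow> weighted_moment J2 \<rho>2 P j = 0"
    and norm2: "weighted_moment J2 \<rho>2 P n2 \<noteq> 0"
    and Wrons_nonzero:
      "\<exists>D w1 w2. branch_off_support A1 B1 J1 D w1 \<and> branch_off_support A2 B2 J2 D w2 \<and>
         (\<exists>z\<in>D. Wrons (poly P) (second_kind J1 \<rho>1 P w1) (second_kind J2 \<rho>2 P w2) z \<noteq> 0)"
  shows
    "\<exists>R E F :: complex poly.
       R \<noteq> 0 \<and>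
       (\<forall>D w1 w2 z.
          branch_off_support A1 B1 J1 D w1 \<and> branch_off_support A2 B2 J2 D w2 \<and> z \<in> D \<longrightarrow>
          (let a1 = poly (cpoly A1) z; a2 = poly (cpoly A2) z;
               v1 = a1 * w1 z; v2 = a2 * w2 z;
               q1 = second_kind J1 \<rho>1 P w1; q2 = second_kind J2 \<rho>2 P w2
           in poly R z = (a1 * a2 * v1 * v2) * Wrons (poly P) q1 q2 z \<and>
              poly E z = a1\<^sup>2 * a2\<^sup>2 * v1 * v2 * deriv_det 0 2 3 (poly P) q1 q2 z \<and>
              poly F z = - (a1\<^sup>2 * a2\<^sup>2 * v1 * v2 * deriv_det 1 2 3 (poly P) q1 q2 z))) \<and>
       int (degree E) \<le>
         Max {int (degree A1) + weight_class A2 B2 + int (degree R),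
              int (degree A2) + weight_class A1 B1 + int (degree R),
              int (degree B1) + int (degree B2) + int (degree R)} \<and>
       int (degree F) \<le> weight_class A1 B1 + weight_class A2 B2 + int (degree R) + 1 \<and>
       (let c3 = cpoly A1 * cpoly A2 * R;
            c2 = (cpoly A1 * (2 * pderiv (cpoly A2) + cpoly B2)
                  + cpoly A2 * (2 * pderiv (cpoly A1) + cpoly B1)) * R
                 - cpoly A1 * cpoly A2 * pderiv R
        in solves_ode3 c3 c2 E F UNIV (poly P) \<and>
           (\<forall>D w1. branch_off_support A1 B1 J1 D w1 \<longrightarrow>
              solves_ode3 c3 c2 E F D (second_kind J1 \<rho>1 P w1)) \<and>
           (\<forall>D w2. branch_off_support A2 B2 J2 D w2 \<longrightarrow>
              solves_ode3 c3 c2 E F D (second_kind J2 \<rho>2 P w2)) \<and>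
           (\<forall>A B. A1 = A \<and> A2 = A \<and> B1 = B \<and> B2 = B \<and> weight_class A B = 1 \<and> n1 = n2 \<longrightarrow>
              (\<exists>Es Fs :: complex poly.
                 degree Es \<le> 4 \<and> degree Fs \<le> 3 \<and>
                 (let d3 = (cpoly A)\<^sup>2;
                      d2 = 2 * cpoly A * (pderiv (cpoly A) + cpoly B)
                  in c3 = R * d3 \<and> c2 = R * d2 \<and> E = R * Es \<and> F = R * Fs \<and>
                     solves_ode3 d3 d2 Es Fs UNIV (poly P) \<and>
                     (\<forall>D w1. branch_off_support A B J1 D w1 \<longrightarrow>
                        solves_ode3 d3 d2 Es Fs D (second_kind J1 \<rho>1 P w1)) \<and>
                     (\<forall>D w2. branch_off_support A B J2 D w2 \<longrightarrow>
                        solves_ode3 d3 d2 Es Fs D (second_kind J2 \<rho>2 P w2))))))"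
proof -
  obtain \<Psi>1 C1 T1 where
    \<Psi>1: "\<And>z. z \<notin> of_real ` Delta J1 \<Longrightarrow> (\<Psi>1 has_field_derivative deriv \<Psi>1 z) (at z)"
      "\<And>z. z \<notin> of_real ` Delta J1 \<Longrightarrow> poly (cpoly A1) z * deriv \<Psi>1 z = poly (cpoly B1) z * \<Psi>1 z + poly C1 z"
    and q1: "\<And>z w. z \<notin> of_real ` Delta J1 \<Longrightarrow> second_kind J1 \<rho>1 P w z = (poly P z * \<Psi>1 z + poly T1 z) / w z"
    and decay1: "\<And>n. (\<And>j. j < n \<Longrightarrow> weighted_moment J1 \<rho>1 P j = 0) \<Longrightarrow> \<exists>K. \<forall>z. Im z \<noteq> 0 \<longrightarrow>
         norm (z ^ Suc n * (poly P z * \<Psi>1 z + poly T1 z) + weighted_moment J1 \<rho>1 P n) \<le> K / \<bar>Im z\<bar>"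
    using second_kind_representation[OF weight1, of P] by blast
  obtain \<Psi>2 C2 T2 where
    \<Psi>2: "\<And>z. z \<notin> of_real ` Delta J2 \<Longrightarrow> (\<Psi>2 has_field_derivative deriv \<Psi>2 z) (at z)"
      "\<And>z. z \<notin> of_real ` Delta J2 \<Longrightarrow> poly (cpoly A2) z * deriv \<Psi>2 z = poly (cpoly B2) z * \<Psi>2 z + poly C2 z"
    and q2: "\<And>z w. z \<notin> of_real ` Delta J2 \<Longrightarrow> second_kind J2 \<rho>2 P w z = (poly P z * \<Psi>2 z + poly T2 z) / w z"
    and decay2: "\<And>n. (\<And>j. j < n \<Longrightarrow> weighted_moment J2 \<rho>2 P j = 0) \<Longrightarrow> \<exists>K. \<forall>z. Im z \<noteq> 0 \<longrightarrow>
         norm (z ^ Suc n * (poly P z * \<Psi>2 z + poly T2 z) + weighted_moment J2 \<rho>2 P n) \<le> K / \<bar>Im z\<bar>"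
    using second_kind_representation[OF weight2, of P] by blast
  interpret ode: ode_polynomials "cpoly A1" "cpoly B1" C1 T1 "cpoly A2" "cpoly B2" C2 T2 P .
  have data1: "second_kind_data (cpoly A1) (cpoly B1) C1 T1 P \<Psi>1 D w (second_kind J1 \<rho>1 P w)"
    if "branch_off_support A1 B1 J1 D w" for D w
    using that by (rule branch_second_kind_data[OF _ \<Psi>1 q1])
  have data2: "second_kind_data (cpoly A2) (cpoly B2) C2 T2 P \<Psi>2 D w (second_kind J2 \<rho>2 P w)"
    if "branch_off_support A2 B2 J2 D w" for D w
    using that by (rule branch_second_kind_data[OF _ \<Psi>2 q2])
  have eval: "poly (ode.D m i j k) z = (poly (cpoly A1) z ^ m * w1 z) * (poly (cpoly A2) z ^ m * w2 z)
      * deriv_det i j k (poly P) (second_kind J1 \<rho>1 P w1) (second_kind J2 \<rho>2 P w2) z"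
    if "branch_off_support A1 B1 J1 D w1" "branch_off_support A2 B2 J2 D w2" "z \<in> D" "i \<le> m" "j \<le> m" "k \<le> m"
    for D w1 w2 z m i j k
    by (rule ode_polynomials_D_eval[OF data1[OF that(1)] data2[OF that(2)] that(3-6)])
  have A: "cpoly A1 \<noteq> 0" "cpoly A2 \<noteq> 0" and P0: "P \<noteq> 0"
    using weight1 weight2 P_monic by (auto simp: semiclassical_weight_def)
  obtain D0 w10 w20 z0 where 0: "branch_off_support A1 B1 J1 D0 w10" "branch_off_support A2 B2 J2 D0 w20" "z0 \<in> D0"
     and W0: "Wrons (poly P) (second_kind J1 \<rho>1 P w10) (second_kind J2 \<rho>2 P w20) z0 \<noteq> 0"
    using Wrons_nonzero by blast
  have "poly ode.R z0 \<noteq> 0"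
    unfolding ode.R_def
    using eval[OF 0, of 0 2 1 2] W0 data1[OF 0(1)] data2[OF 0(2)] 0(3)
    by (auto simp: second_kind_data_def)
  then have R0: "ode.R \<noteq> 0" by auto
  have deg1: "int (degree (cpoly A1)) \<le> weight_class A1 B1 + 2" "int (degree (cpoly B1)) \<le> weight_class A1 B1 + 1"
   and deg2: "int (degree (cpoly A2)) \<le> weight_class A2 B2 + 2" "int (degree (cpoly B2)) \<le> weight_class A2 B2 + 1"
    by (auto simp: weight_class_def)
  note degE = ode.degree_bound_E[OF A P0 R0 sigma1 deg1 sigma2 deg2]
  note degF = ode.degree_bound_F[OF A P0 R0 sigma1 deg1 sigma2 deg2]
  note col1 = ode.ode_columns[OF disjI2[OF disjI1[OF refl]]]
  note col2 = ode.ode_columns[OF disjI2[OF disjI2[OF refl]]]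
  have equal_weights: "\<exists>Es Fs :: complex poly. degree Es \<le> 4 \<and> degree Fs \<le> 3 \<and>
       ode.c3 = ode.R * (cpoly A1)\<^sup>2 \<and>
       ode.c2 = ode.R * (2 * cpoly A1 * (pderiv (cpoly A1) + cpoly B1)) \<and>
       ode.E = ode.R * Es \<and> ode.F = ode.R * Fs"
    if eq: "A2 = A1" "B2 = B1" and \<sigma>: "weight_class A1 B1 = 1" and n: "n1 = n2"
  proof -
    let ?core = "ode.equal_weight_core"
    obtain K1 where K1: "\<And>z. Im z \<noteq> 0 \<Longrightarrow>
        norm (z ^ Suc n1 * (poly P z * \<Psi>1 z + poly T1 z) + weighted_moment J1 \<rho>1 P n1) \<le> K1 / \<bar>Im z\<bar>"
      using decay1[OF orth1] by blast
    obtain K2 where K2: "\<And>z. Im z \<noteq> 0 \<Longrightarrow>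
        norm (z ^ Suc n1 * (poly P z * \<Psi>2 z + poly T2 z) + weighted_moment J2 \<rho>2 P n1) \<le> K2 / \<bar>Im z\<bar>"
      using decay2[OF orth2] unfolding n by blast
    have off: "z \<notin> of_real ` Delta J" if "Im z > 0" for z J using that by auto
    have K1': "norm (z ^ Suc n1 * (poly P z * \<Psi>1 z + poly T1 z) + weighted_moment J1 \<rho>1 P n1) \<le> K1 / Im z"
     and K2': "norm (z ^ Suc n1 * (poly P z * \<Psi>2 z + poly T2 z) + weighted_moment J2 \<rho>2 P n1) \<le> K2 / Im z"
      if "Im z > 0" for z using K1[of z] K2[of z] that by simp_all
    \<comment> \<open>A weight of class 1 has \<open>deg A \<le> 3\<close> and \<open>deg B \<le> 2\<close>.\<close>
    have "degree_le (cpoly A1) 3" "degree_le (cpoly B1) 2" "degree_le P (2 * int n1)"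
      using \<sigma> n P_degree by (auto simp: degree_le_def weight_class_def)
    then have "degree ?core = 0"
      by (intro equal_weight_core_constant[OF \<Psi>1(1)[OF off] \<Psi>1(2)[OF off] \<Psi>2(1)[OF off]
            \<Psi>2(2)[OF off, unfolded eq] K1' K2' norm1])
    then obtain \<kappa> where core: "?core = [:\<kappa>:]" by (rule degree_eq_zeroE)
    have R: "ode.R = (cpoly A1)\<^sup>2 * [:\<kappa>:]"
      using ode.equal_weight_factorisation core eq by simp
    have \<kappa>: "\<kappa> \<noteq> 0" using R R0 by auto
    obtain e f where ef: "ode.E = (cpoly A1)\<^sup>2 * e" "ode.F = (cpoly A1)\<^sup>2 * f"
      using ode.equal_weight_dvd eq unfolding dvd_def by auto
    define Es where "Es = smult (1 / \<kappa>) e"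
    define Fs where "Fs = smult (1 / \<kappa>) f"
    have E: "ode.E = ode.R * Es" and F: "ode.F = ode.R * Fs"
      using \<kappa> by (simp_all add: R ef Es_def Fs_def)
    have "degree Es \<le> 4"
    proof (cases "Es = 0")
      case False
      then have "degree ode.E = degree ode.R + degree Es" using R0 by (simp add: E degree_mult_eq)
      then show ?thesis using degE \<sigma> deg1 by (auto simp: eq)
    qed simp
    moreover have "degree Fs \<le> 3"
    proof (cases "Fs = 0")
      case False
      then have "degree ode.F = degree ode.R + degree Fs" using R0 by (simp add: F degree_mult_eq)
      then show ?thesis using degF \<sigma> by (auto simp: eq)
    qed simp
    moreover have "ode.c3 = ode.R * (cpoly A1)\<^sup>2"
      unfolding ode.c3_def by (simp add: eq power2_eq_square mult_ac)
    moreover have "ode.c2 = ode.R * (2 * cpoly A1 * (pderiv (cpoly A1) + cpoly B1))"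
    proof -
      have "pderiv ode.R = 2 * pderiv (cpoly A1) * cpoly A1 * [:\<kappa>:]"
      proof -
        have "a * a * 0 + k * (a * a' + a * a') = 2 * a' * a * k" for a a' k :: "complex poly"
          by (simp add: algebra_simps)
        moreover have "pderiv [:\<kappa>:] = 0" by (simp add: pderiv_pCons)
        ultimately show ?thesis unfolding R power2_eq_square pderiv_mult by (simp only:)
      qed
      moreover have "ode.c2 = (cpoly A1 * (2 * pderiv (cpoly A1) + cpoly B1)
          + cpoly A1 * (2 * pderiv (cpoly A1) + cpoly B1)) * ode.R - cpoly A1 * cpoly A1 * pderiv ode.R"
        unfolding ode.c2_def by (simp only: eq)
      moreover have "(a * (2 * a' + b) + a * (2 * a' + b)) * (a\<^sup>2 * k) - a * a * (2 * a' * a * k)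
          = a\<^sup>2 * k * (2 * a * (a' + b))" for a a' b k :: "complex poly"
        by (simp add: algebra_simps power2_eq_square)
      ultimately show ?thesis unfolding R by (simp only:)
    qed
    ultimately show ?thesis using E F by blast
  qed
  show ?thesis
    unfolding Let_def
  proof (rule exI[of _ ode.R], rule exI[of _ ode.E], rule exI[of _ ode.F], intro conjI)
    show "ode.R \<noteq> 0" by (rule R0)
    show "\<forall>D w1 w2 z.
          branch_off_support A1 B1 J1 D w1 \<and> branch_off_support A2 B2 J2 D w2 \<and> z \<in> D \<longrightarrow>
          poly ode.R z = (poly (cpoly A1) z * poly (cpoly A2) z * (poly (cpoly A1) z * w1 z) * (poly (cpoly A2) z * w2 z))
              * Wrons (poly P) (second_kind J1 \<rho>1 P w1) (second_kind J2 \<rho>2 P w2) z \<and>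
          poly ode.E z = (poly (cpoly A1) z)\<^sup>2 * (poly (cpoly A2) z)\<^sup>2 * (poly (cpoly A1) z * w1 z) * (poly (cpoly A2) z * w2 z)
              * deriv_det 0 2 3 (poly P) (second_kind J1 \<rho>1 P w1) (second_kind J2 \<rho>2 P w2) z \<and>
          poly ode.F z = - ((poly (cpoly A1) z)\<^sup>2 * (poly (cpoly A2) z)\<^sup>2 * (poly (cpoly A1) z * w1 z) * (poly (cpoly A2) z * w2 z)
              * deriv_det 1 2 3 (poly P) (second_kind J1 \<rho>1 P w1) (second_kind J2 \<rho>2 P w2) z)"
      unfolding ode.R_def ode.E_def ode.F_def
      by (auto simp: eval power2_eq_square power3_eq_cube)
    show "int (degree ode.E) \<le>
         Max {int (degree A1) + weight_class A2 B2 + int (degree ode.R),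
              int (degree A2) + weight_class A1 B1 + int (degree ode.R),
              int (degree B1) + int (degree B2) + int (degree ode.R)}"
      using degE by auto
    show "int (degree ode.F) \<le> weight_class A1 B1 + weight_class A2 B2 + int (degree ode.R) + 1"
      by (rule degF)
    show "solves_ode3 (cpoly A1 * cpoly A2 * ode.R)
      ((cpoly A1 * (2 * pderiv (cpoly A2) + cpoly B2) + cpoly A2 * (2 * pderiv (cpoly A1) + cpoly B1)) * ode.R
         - cpoly A1 * cpoly A2 * pderiv ode.R) ode.E ode.F UNIV (poly P)"
      unfolding ode.c3_def[symmetric] ode.c2_def[symmetric]
      by (rule solves_ode3_poly[OF ode.ode_P])
    show "\<forall>D w1. branch_off_support A1 B1 J1 D w1 \<longrightarrow> solves_ode3 (cpoly A1 * cpoly A2 * ode.R)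
      ((cpoly A1 * (2 * pderiv (cpoly A2) + cpoly B2) + cpoly A2 * (2 * pderiv (cpoly A1) + cpoly B1)) * ode.R
         - cpoly A1 * cpoly A2 * pderiv ode.R) ode.E ode.F D (second_kind J1 \<rho>1 P w1)"
      unfolding ode.c3_def[symmetric] ode.c2_def[symmetric]
      using solves_ode3_second_kind[OF data1 ode.ode_P col1] by blast
    show "\<forall>D w2. branch_off_support A2 B2 J2 D w2 \<longrightarrow> solves_ode3 (cpoly A1 * cpoly A2 * ode.R)
      ((cpoly A1 * (2 * pderiv (cpoly A2) + cpoly B2) + cpoly A2 * (2 * pderiv (cpoly A1) + cpoly B1)) * ode.R
         - cpoly A1 * cpoly A2 * pderiv ode.R) ode.E ode.F D (second_kind J2 \<rho>2 P w2)"
      unfolding ode.c3_def[symmetric] ode.c2_def[symmetric]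
      using solves_ode3_second_kind[OF data2 ode.ode_P col2] by blast
  next
    show "\<forall>A B. A1 = A \<and> A2 = A \<and> B1 = B \<and> B2 = B \<and> weight_class A B = 1 \<and> n1 = n2 \<longrightarrow>
       (\<exists>Es Fs. degree Es \<le> 4 \<and> degree Fs \<le> 3 \<and>
          cpoly A1 * cpoly A2 * ode.R = ode.R * (cpoly A)\<^sup>2 \<and>
          (cpoly A1 * (2 * pderiv (cpoly A2) + cpoly B2) + cpoly A2 * (2 * pderiv (cpoly A1) + cpoly B1)) * ode.R
            - cpoly A1 * cpoly A2 * pderiv ode.R = ode.R * (2 * cpoly A * (pderiv (cpoly A) + cpoly B)) \<and>
          ode.E = ode.R * Es \<and> ode.F = ode.R * Fs \<and>
          solves_ode3 ((cpoly A)\<^sup>2) (2 * cpoly A * (pderiv (cpoly A) + cpoly B)) Es Fs UNIV (poly P) \<and>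
          (\<forall>D w1. branch_off_support A B J1 D w1 \<longrightarrow>
             solves_ode3 ((cpoly A)\<^sup>2) (2 * cpoly A * (pderiv (cpoly A) + cpoly B)) Es Fs D (second_kind J1 \<rho>1 P w1)) \<and>
          (\<forall>D w2. branch_off_support A B J2 D w2 \<longrightarrow>
             solves_ode3 ((cpoly A)\<^sup>2) (2 * cpoly A * (pderiv (cpoly A) + cpoly B)) Es Fs D (second_kind J2 \<rho>2 P w2)))"
      unfolding ode.c3_def[symmetric] ode.c2_def[symmetric]
    proof (intro allI impI, elim conjE)
      fix A B
      assume A1: "A1 = A" and A2: "A2 = A" and B1: "B1 = B" and B2: "B2 = B"
        and \<sigma>: "weight_class A B = 1" and n: "n1 = n2"
      obtain Es Fs where deg: "degree Es \<le> 4" "degree Fs \<le> 3"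
        and c: "ode.c3 = ode.R * (cpoly A)\<^sup>2" "ode.c2 = ode.R * (2 * cpoly A * (pderiv (cpoly A) + cpoly B))"
          "ode.E = ode.R * Es" "ode.F = ode.R * Fs"
        using equal_weights[unfolded A1 A2 B1 B2, OF refl refl \<sigma> n] unfolding A1 A2 B1 B2 by blast
      have cancel: "(cpoly A)\<^sup>2 * y3 + 2 * cpoly A * (pderiv (cpoly A) + cpoly B) * y2 + Es * y1 + Fs * y0 = 0"
        if "ode.c3 * y3 + ode.c2 * y2 + ode.E * y1 + ode.F * y0 = 0" for y3 y2 y1 y0
      proof -
        have "ode.R * ((cpoly A)\<^sup>2 * y3 + 2 * cpoly A * (pderiv (cpoly A) + cpoly B) * y2 + Es * y1 + Fs * y0) = 0"
          using that unfolding c by (simp add: algebra_simps)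
        then show ?thesis using R0 by simp
      qed
      note P = cancel[OF ode.ode_P]
      show "\<exists>Es Fs. degree Es \<le> 4 \<and> degree Fs \<le> 3 \<and>
          ode.c3 = ode.R * (cpoly A)\<^sup>2 \<and>
          ode.c2 = ode.R * (2 * cpoly A * (pderiv (cpoly A) + cpoly B)) \<and>
          ode.E = ode.R * Es \<and> ode.F = ode.R * Fs \<and>
          solves_ode3 ((cpoly A)\<^sup>2) (2 * cpoly A * (pderiv (cpoly A) + cpoly B)) Es Fs UNIV (poly P) \<and>
          (\<forall>D w1. branch_off_support A B J1 D w1 \<longrightarrow>
             solves_ode3 ((cpoly A)\<^sup>2) (2 * cpoly A * (pderiv (cpoly A) + cpoly B)) Es Fs D (second_kind J1 \<rho>1 P w1)) \<and>
          (\<forall>D w2. branch_off_support A B J2 D w2 \<longrightarrow>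
             solves_ode3 ((cpoly A)\<^sup>2) (2 * cpoly A * (pderiv (cpoly A) + cpoly B)) Es Fs D (second_kind J2 \<rho>2 P w2))"
        using deg c solves_ode3_poly[OF P] solves_ode3_second_kind[OF data1 P cancel[OF col1]]
          solves_ode3_second_kind[OF data2 P cancel[OF col2]] A1 A2 B1 B2
        by blast
    qed
  qed
qed

end
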